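(* Let $d\ge 3$, let $\{W(t);t\in[0,1]\}$ be a Brownian motion in $\mathbb{R}^d$ started at $x\in\mathbb{R}^d$ (with law $P_x$), and let $n\ge1$. Let $z_1,\dots,z_n\in\mathbb{R}^d$ be fixed points, all different from $x$, with $z_k\ne z_j$ for $k\ne j$. Then, as $\varepsilon\to0_+$, $$P_x\{\exists\, 0\le t_1<\dots<t_n\le 1:\ W(t_1)\in B(z_1,\varepsilon),\ W(t_2)\in B(z_2,\varepsilon),\dots,W(t_n)\in B(z_n,\varepsilon)\}$$ $$\asymp\ \|x-z_1\|^{2-d}\,\|z_1-z_2\|^{2-d}\cdots\|z_{n-1}-z_n\|^{2-d}\,(\varepsilon^{d-2})^{n}.$$
   Context: $\|\cdot\|$ is the Euclidean norm and $B(z,\varepsilon)$ is the (closed) ball of radius $\varepsilon$ centred at $z$. The notation $F(\varepsilon)\asymp G(\varepsilon)$ as $\varepsilon\to0_+$ means that there exist $\varepsilon_0>0$ and constants $0<c\le C<\infty$, not depending on $\varepsilon$ (they may depend on $d$, $n$ and the fixed points $x,z_1,\dots,z_n$), such that $c\,G(\varepsilon)\le F(\varepsilon)\le C\,G(\varepsilon)$ for all $0<\varepsilon<\varepsilon_0$. *)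

theory Defs
  imports "HOL-Probability.Probability"
begin

text \<open>The \<open>d\<close>-dimensional normal law \<open>N(0, s I)\<close>, for \<open>s > 0\<close>; \<open>normal_density\<close> takes the standard
  deviation, hence the square root.\<close>

definition gaussian_density :: "real \<Rightarrow> 'a::euclidean_space \<Rightarrow> real" where
  "gaussian_density s y = (\<Prod>b\<in>Basis. normal_density 0 (sqrt s) (y \<bullet> b))"

text \<open>Only the times in \<open>[0,1]\<close> matter; \<open>W t\<close> is unconstrained for other \<open>t\<close>. Every path is
  continuous (not just almost every one), so that events such as hitting a closed ball are
  measurable without completing \<open>M\<close>.\<close>

locale brownian_motion = prob_space M
  for M :: "'w measure" and x :: "'a::euclidean_space" and W :: "real \<Rightarrow> 'w \<Rightarrow> 'a" +
  assumes measurable_W: "t \<in> {0..1} \<Longrightarrow> W t \<in> borel_measurable M"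
    and start: "AE \<omega> in M. W 0 \<omega> = x"
    and continuous_paths: "\<omega> \<in> space M \<Longrightarrow> continuous_on {0..1} (\<lambda>t. W t \<omega>)"
    and indep_increments: "strict_mono_on {..m} \<tau> \<Longrightarrow> \<tau> ` {..m} \<subseteq> {0..1} \<Longrightarrow>
      indep_vars (\<lambda>_. borel) (\<lambda>i \<omega>. W (\<tau> (Suc i)) \<omega> - W (\<tau> i) \<omega>) {..<m::nat}"
    and gaussian_increments: "0 \<le> s \<Longrightarrow> s < t \<Longrightarrow> t \<le> 1 \<Longrightarrow>
      distributed M lborel (\<lambda>\<omega>. W t \<omega> - W s \<omega>) (\<lambda>y. ennreal (gaussian_density (t - s) y))"

end

theory Submission
  imports Defs
begin

text \<open>Only the independence and the law of the increments are used; there is no stopping time.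

  Upper bound: put \<open>N \<approx> \<epsilon>^-2\<close> cells on \<open>[0,1]\<close>. If \<open>W t\<close> is within \<open>\<epsilon>\<close> of \<open>z\<close> and \<open>u\<close> is the left end of
  the cell of \<open>t\<close>, then either \<open>W u\<close> is within \<open>4 \<epsilon>\<close> of \<open>z\<close>, or \<open>W u\<close> is at distance about \<open>2^m \<epsilon>\<close> and
  some increment on a dyadic-type subinterval of the cell is untypically large, by chaining. For a
  point at distance bounded below, an increment over any time lies in a ball of radius \<open>r\<close> with
  probability \<open>O(r^d)\<close>, and large increments are rarer than any power, so a union bound over the
  cells yields a factor \<open>O(\<epsilon>^-2 \<epsilon>^d)\<close> for each of the \<open>n\<close> points. Two of the balls are visited in the same
  cell only with probability smaller than any power of \<open>\<epsilon>\<close>.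

  Lower bound: second moment method for the number of \<open>n\<close>-tuples of times, one from each of \<open>n\<close>
  separated windows discretised at scale \<open>\<epsilon>\<^sup>2\<close>, at which the balls are visited. The second moment
  factorises over the windows and each factor is controlled because \<open>\<Sum>j. j powr (- d / 2)\<close>
  converges for \<open>d \<ge> 3\<close>.\<close>

section \<open>Gaussian increments and cylinder events\<close>

text \<open>The constants may depend on the points, so the product of norms in \<open>G\<close> is a
  fixed positive number and both bounds are proved against \<open>(\<epsilon> ^ (d - 2)) ^ n\<close>
  alone. Independence is available only across deterministic times, while a visit happens at a
  random one. Visits are therefore enclosed in (upper bound) or produced by (lower bound) events
  about increments between fixed grid times. The price in the upper bound is that the position at a
  grid time is known only up to some radius \<open>r \<ge> \<epsilon>\<close>. The induction over
  the points carries a weight \<open>(r / \<epsilon>) ^ d\<close> for this: knowing the start up to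
  \<open>r\<close> enlarges the target of the next increment to a ball of radius of order
  \<open>r\<close>. Positions known only at scale \<open>2 ^ m * \<epsilon>\<close> are affordable
  because reaching the small ball from there within a cell needs a jump whose probability decays
  faster in \<open>m\<close> than the weight grows. In the lower bound the gap between windows
  bounds the density of the connecting increment regardless of where the path is, so two tuples of
  times interact only within the same window.\<close>

lemma gaussian_density_eq:
  fixes y :: "'a::euclidean_space"
  assumes "s > 0"
  shows "gaussian_density s y = exp (- (norm y)\<^sup>2 / (2 * s)) / sqrt (2 * pi * s) ^ DIM('a)"
proof -
  have "(\<Sum>b\<in>Basis. (y \<bullet> b)\<^sup>2) = (norm y)\<^sup>2"
    by (subst power2_norm_eq_inner, subst euclidean_inner) (simp add: power2_eq_square)
  then have "(\<Prod>b\<in>Basis. exp (- (y \<bullet> b)\<^sup>2 / (2 * s))) = exp (- (norm y)\<^sup>2 / (2 * s))"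
    by (simp add: exp_sum[symmetric] sum_divide_distrib[symmetric] sum_negf)
  then show ?thesis
    using assms by (simp add: gaussian_density_def normal_density_def prod_dividef)
qed

lemma gaussian_density_nonneg: "0 \<le> gaussian_density s y"
  unfolding gaussian_density_def by (intro prod_nonneg) auto

lemma borel_measurable_gaussian_density [measurable]:
  "gaussian_density s \<in> borel_measurable borel"
  unfolding gaussian_density_def by measurable

lemma nn_integral_gaussian_density:
  assumes "s > 0"
  shows "(\<integral>\<^sup>+y. ennreal (gaussian_density s (y::'a::euclidean_space)) \<partial>lborel) = 1"
proof -
  have 1: "(\<integral>\<^sup>+u. ennreal (normal_density 0 (sqrt s) u) \<partial>lborel) = 1"
    using assms
    by (subst nn_integral_eq_integral)
      (auto intro: integrable_normal_density integral_normal_density)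
  have "(\<integral>\<^sup>+y. ennreal (gaussian_density s (y::'a)) \<partial>lborel)
      = (\<integral>\<^sup>+y. (\<Prod>b\<in>(Basis :: 'a set). ennreal (normal_density 0 (sqrt s) (y \<bullet> b))) \<partial>lborel)"
    unfolding gaussian_density_def by (simp add: prod_ennreal)
  also have "\<dots> = 1"
    by (subst nn_integral_lborel_prod) (auto simp: 1)
  finally show ?thesis .
qed

text \<open>Up to the factor \<open>fact q\<close> the left side is one term of the exponential
  series. The Gaussian upper bounds use the decay of \<open>exp\<close> only in this form, with a
  power chosen to beat whatever competes with it.\<close>

lemma power_le_fact_mult_exp:
  fixes u :: real
  assumes "u \<ge> 0"
  shows "u ^ q \<le> fact q * exp u"
proof -
  have "(\<Sum>n\<in>{q}. u ^ n /\<^sub>R fact n) \<le> (\<Sum>n. u ^ n /\<^sub>R fact n)"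
    using assms by (intro sum_le_suminf summable_exp_generic) auto
  then have "u ^ q / fact q \<le> exp u"
    by (simp add: exp_def divide_inverse mult.commute)
  then show ?thesis by (simp add: field_simps)
qed

lemma exp_minus_le:
  fixes u :: real
  assumes "u > 0"
  shows "exp (- u) \<le> fact q / u ^ q"
  using power_le_fact_mult_exp[of u q] assms by (simp add: exp_minus field_simps)

lemma nn_integral_density_cball_le:
  fixes f :: "'a::euclidean_space \<Rightarrow> real"
  assumes "\<And>y. y \<in> cball w r \<Longrightarrow> f y \<le> K" "K \<ge> 0" "r \<ge> 0"
  shows "(\<integral>\<^sup>+y. ennreal (f y) * indicator (cball w r) y \<partial>lborel)
    \<le> ennreal (K * unit_ball_vol DIM('a) * r ^ DIM('a))"
proof -
  have "(\<integral>\<^sup>+y. ennreal (f y) * indicator (cball w r) y \<partial>lborel)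
      \<le> (\<integral>\<^sup>+y. ennreal K * indicator (cball w r) y \<partial>lborel)"
    using assms by (intro nn_integral_mono) (auto split: split_indicator simp: ennreal_leI)
  also have "\<dots> = ennreal K * emeasure lborel (cball w r)"
    by (simp add: nn_integral_cmult_indicator)
  also have "\<dots> = ennreal (K * unit_ball_vol DIM('a) * r ^ DIM('a))"
    using assms by (simp add: emeasure_cball ennreal_mult' mult.assoc)
  finally show ?thesis .
qed

lemma nn_integral_density_cball_ge:
  fixes f :: "'a::euclidean_space \<Rightarrow> real"
  assumes "\<And>y. y \<in> cball w r \<Longrightarrow> f y \<ge> K" "K \<ge> 0" "r \<ge> 0"
  shows "(\<integral>\<^sup>+y. ennreal (f y) * indicator (cball w r) y \<partial>lborel)
    \<ge> ennreal (K * unit_ball_vol DIM('a) * r ^ DIM('a))"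
proof -
  have "ennreal (K * unit_ball_vol DIM('a) * r ^ DIM('a)) = ennreal K * emeasure lborel (cball w r)"
    using assms by (simp add: emeasure_cball ennreal_mult' mult.assoc)
  also have "\<dots> = (\<integral>\<^sup>+y. ennreal K * indicator (cball w r) y \<partial>lborel)"
    by (simp add: nn_integral_cmult_indicator)
  also have "\<dots> \<le> (\<integral>\<^sup>+y. ennreal (f y) * indicator (cball w r) y \<partial>lborel)"
    using assms by (intro nn_integral_mono) (auto split: split_indicator simp: ennreal_leI)
  finally show ?thesis .
qed

lemma gaussian_density_le:
  fixes y :: "'a::euclidean_space"
  assumes "s > 0"
  shows "gaussian_density s y \<le> 1 / sqrt s ^ DIM('a)"
proof -
  have "sqrt s ^ DIM('a) \<le> sqrt (2 * pi * s) ^ DIM('a)"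
    using assms pi_ge_two by (intro power_mono) (auto simp: mult_le_cancel_right1)
  then show ?thesis
    unfolding gaussian_density_eq[OF assms] using assms
    by (intro frac_le) auto
qed

text \<open>Uniform in the elapsed time: away from the origin the exponential contributes
  \<open>s ^ d\<close>, which absorbs the singular factor \<open>s\<close> to the power
  \<open>- d / 2\<close> of the density as \<open>s\<close> tends to 0.\<close>

lemma gaussian_density_away_le:
  fixes y :: "'a::euclidean_space"
  assumes s: "0 < s" "s \<le> 1" and y: "norm y \<ge> \<rho>" and "\<rho> > 0"
  shows "gaussian_density s y \<le> fact DIM('a) * (2 / \<rho>\<^sup>2) ^ DIM('a)"
proof -
  let ?d = "DIM('a)"
  have "sqrt s ^ ?d \<le> sqrt (2 * pi * s) ^ ?d"
    using assms pi_ge_two by (intro power_mono) (auto simp: mult_le_cancel_right1)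
  moreover have "exp (- (norm y)\<^sup>2 / (2 * s)) \<le> exp (- (\<rho>\<^sup>2 / (2 * s)))"
    using assms by (auto intro!: divide_right_mono power_mono)
  moreover have "exp (- (\<rho>\<^sup>2 / (2 * s))) \<le> fact ?d / (\<rho>\<^sup>2 / (2 * s)) ^ ?d"
    using assms by (intro exp_minus_le) auto
  ultimately have "gaussian_density s y \<le> (fact ?d / (\<rho>\<^sup>2 / (2 * s)) ^ ?d) / sqrt s ^ ?d"
    unfolding gaussian_density_eq[OF s(1)] using s by (intro frac_le) (linarith | simp)+
  also have "\<dots> = fact ?d * (2 / \<rho>\<^sup>2) ^ ?d * (s / sqrt s) ^ ?d"
    using assms by (simp add: field_simps power_mult_distrib power_divide)
  also have "s / sqrt s = sqrt s"
    using s by (simp add: real_div_sqrt)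
  also have "fact ?d * (2 / \<rho>\<^sup>2) ^ ?d * sqrt s ^ ?d \<le> fact ?d * (2 / \<rho>\<^sup>2) ^ ?d * 1"
    using s by (intro mult_left_mono power_le_one) auto
  finally show ?thesis by simp
qed

text \<open>The exponent is split in two equal halves. One half turns the density into that of
  variance \<open>2 * s\<close>, of total mass 1, at the cost \<open>sqrt 2 ^ DIM('a)\<close>; the
  other is at least \<open>r\<^sup>2 / (4 * s)\<close> and yields the power. No radial integration
  is involved.\<close>

lemma gaussian_tail:
  fixes q :: nat
  assumes s: "0 < s" and r: "0 < r"
  shows "(\<integral>\<^sup>+y. ennreal (gaussian_density s (y::'a::euclidean_space)) * indicator {y. norm y \<ge> r} y \<partial>lborel)
    \<le> ennreal (sqrt 2 ^ DIM('a) * fact q * 4 ^ q * (s / r\<^sup>2) ^ q)"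
proof -
  let ?d = "DIM('a)"
  let ?K = "sqrt 2 ^ ?d * fact q * 4 ^ q * (s / r\<^sup>2) ^ q"
  have pt: "gaussian_density s y \<le> ?K * gaussian_density (2 * s) y" if "norm y \<ge> r" for y :: 'a
  proof -
    have "exp (- (norm y)\<^sup>2 / (4 * s)) \<le> exp (- (r\<^sup>2 / (4 * s)))"
      using s r that by (auto intro!: divide_right_mono power_mono)
    also have "\<dots> \<le> fact q / (r\<^sup>2 / (4 * s)) ^ q"
      using s r by (intro exp_minus_le) auto
    also have "\<dots> = fact q * 4 ^ q * (s / r\<^sup>2) ^ q"
      using s r by (simp add: field_simps power_mult_distrib power_divide)
    finally have e: "exp (- (norm y)\<^sup>2 / (4 * s)) \<le> fact q * 4 ^ q * (s / r\<^sup>2) ^ q" .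
    have sp: "exp (- (norm y)\<^sup>2 / (2 * s)) = exp (- (norm y)\<^sup>2 / (4 * s)) * exp (- (norm y)\<^sup>2 / (2 * (2 * s)))"
      by (simp add: exp_add[symmetric] field_simps)
    have "sqrt (2 * pi * (2 * s)) = sqrt 2 * sqrt (2 * pi * s)"
      by (simp add: real_sqrt_mult[symmetric])
    then have sq: "sqrt (2 * pi * (2 * s)) ^ ?d = sqrt 2 ^ ?d * sqrt (2 * pi * s) ^ ?d"
      by (simp only: power_mult_distrib)
    have "gaussian_density (2 * s) y = exp (- (norm y)\<^sup>2 / (2 * (2 * s))) / (sqrt 2 ^ ?d * sqrt (2 * pi * s) ^ ?d)"
      using gaussian_density_eq[of "2 * s" y] s unfolding sq by simp
    then have "gaussian_density s y = sqrt 2 ^ ?d * exp (- (norm y)\<^sup>2 / (4 * s)) * gaussian_density (2 * s) y"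
      unfolding gaussian_density_eq[OF s] sp by simp
    also have "\<dots> \<le> sqrt 2 ^ ?d * (fact q * 4 ^ q * (s / r\<^sup>2) ^ q) * gaussian_density (2 * s) y"
      using e by (intro mult_right_mono mult_left_mono gaussian_density_nonneg) auto
    finally show ?thesis by (simp add: mult.assoc)
  qed
  have "(\<integral>\<^sup>+y. ennreal (gaussian_density s (y::'a)) * indicator {y. norm y \<ge> r} y \<partial>lborel)
      \<le> (\<integral>\<^sup>+y. ennreal ?K * ennreal (gaussian_density (2 * s) (y::'a)) \<partial>lborel)"
    using pt s gaussian_density_nonneg[of "2 * s"]
    by (intro nn_integral_mono) (auto split: split_indicator simp: ennreal_mult'[symmetric] ennreal_leI)
  also have "\<dots> = ennreal ?K"
    using s by (simp add: nn_integral_cmult nn_integral_gaussian_density)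
  finally show ?thesis .
qed

section \<open>Probability estimates for a single increment\<close>

context brownian_motion
begin

lemma measurable_increment [measurable]:
  assumes "s \<in> {0..1}" "t \<in> {0..1}"
  shows "(\<lambda>\<omega>. W t \<omega> - W s \<omega>) \<in> borel_measurable M"
  using measurable_W[OF assms(1)] measurable_W[OF assms(2)] by measurable

lemma sets_increment:
  assumes "s \<in> {0..1}" "t \<in> {0..1}" "B \<in> sets borel"
  shows "{\<omega> \<in> space M. W t \<omega> - W s \<omega> \<in> B} \<in> sets M"
  using measurable_increment[OF assms(1,2)] assms(3) by measurable

lemma emeasure_increment:
  assumes "0 \<le> s" "s < t" "t \<le> 1" "B \<in> sets borel"
  shows "ennreal (prob {\<omega> \<in> space M. W t \<omega> - W s \<omega> \<in> B})
    = (\<integral>\<^sup>+y. ennreal (gaussian_density (t - s) y) * indicator B y \<partial>lborel)"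
  using distributed_emeasure[OF gaussian_increments[OF assms(1-3)], of B] assms(4)
  by (simp add: emeasure_eq_measure vimage_def Int_def conj_commute)

lemma prob_increment_le:
  assumes "0 \<le> s" "s < t" "t \<le> 1" "B \<in> sets borel" "0 \<le> K"
    and "(\<integral>\<^sup>+y. ennreal (gaussian_density (t - s) y) * indicator B y \<partial>lborel) \<le> ennreal K"
  shows "prob {\<omega> \<in> space M. W t \<omega> - W s \<omega> \<in> B} \<le> K"
proof -
  have "ennreal (prob {\<omega> \<in> space M. W t \<omega> - W s \<omega> \<in> B}) \<le> ennreal K"
    unfolding emeasure_increment[OF assms(1-4)] by (rule assms(6))
  then show ?thesis using assms(5) ennreal_le_iff by blast
qed

text \<open>One constant has to serve all radii. For \<open>r < \<rho> / 2\<close> the ball keeps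
  distance \<open>\<rho> / 2\<close> from the origin, whence
  \<open>2 / (\<rho> / 2)\<^sup>2 = 8 / \<rho>\<^sup>2\<close>, and a zero increment
  (\<open>s = t\<close>) misses it. For larger \<open>r\<close> the second summand alone makes the
  bound at least 1.\<close>

lemma prob_increment_away_le:
  assumes "0 \<le> s" "s \<le> t" "t \<le> 1" "\<rho> > 0" "norm w \<ge> \<rho>" "r \<ge> 0"
  shows "prob {\<omega> \<in> space M. W t \<omega> - W s \<omega> \<in> cball w r}
    \<le> (fact DIM('a) * (8 / \<rho>\<^sup>2) ^ DIM('a) * unit_ball_vol DIM('a) + (2 / \<rho>) ^ DIM('a)) * r ^ DIM('a)"
    (is "_ \<le> (?K1 + ?K2) * _")
proof -
  have K: "?K1 \<ge> 0" "?K2 \<ge> 0" using assms by auto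
  show ?thesis
  proof (cases "r < \<rho> / 2")
    case False
    then have "1 \<le> (2 / \<rho> * r) ^ DIM('a)"
      using assms by (intro one_le_power) (simp add: field_simps)
    also have "\<dots> = ?K2 * r ^ DIM('a)" by (rule power_mult_distrib)
    also have "\<dots> \<le> (?K1 + ?K2) * r ^ DIM('a)"
      using K assms by (intro mult_right_mono) auto
    finally show ?thesis using prob_le_1 order_trans by blast
  next
    case True
    show ?thesis
    proof (cases "s = t")
      case eq: True
      then have "{\<omega> \<in> space M. W t \<omega> - W s \<omega> \<in> cball w r} = {}"
        using True assms by auto
      then show ?thesis using K assms by (simp only: measure_empty) auto
    next
      case False
      have "prob {\<omega> \<in> space M. W t \<omega> - W s \<omega> \<in> cball w r} \<le> ?K1 * r ^ DIM('a)"
      proof (rule prob_increment_le)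
        have "norm y \<ge> \<rho> / 2" if "y \<in> cball w r" for y
          using that True assms norm_triangle_ineq2[of w y] by (auto simp: dist_norm)
        then have "gaussian_density (t - s) y \<le> fact DIM('a) * (2 / (\<rho> / 2)\<^sup>2) ^ DIM('a)"
          if "y \<in> cball w r" for y using that False assms
          by (intro gaussian_density_away_le) auto
        moreover have "2 / (\<rho> / 2)\<^sup>2 = 8 / \<rho>\<^sup>2" by (simp add: power_divide)
        ultimately show "(\<integral>\<^sup>+y. ennreal (gaussian_density (t - s) y) * indicator (cball w r) y \<partial>lborel)
          \<le> ennreal (?K1 * r ^ DIM('a))"
          using assms by (intro nn_integral_density_cball_le) auto
      qed (use assms False K in auto)
      also have "\<dots> \<le> (?K1 + ?K2) * r ^ DIM('a)"
        using K assms by (intro mult_right_mono) auto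
      finally show ?thesis .
    qed
  qed
qed

lemma prob_increment_tail_le:
  assumes "0 \<le> s" "s \<le> t" "t \<le> 1" "r > 0" "(t - s) / r\<^sup>2 \<le> \<eta>"
  shows "prob {\<omega> \<in> space M. W t \<omega> - W s \<omega> \<in> {y. norm y \<ge> r}}
    \<le> sqrt 2 ^ DIM('a) * fact q * 4 ^ q * \<eta> ^ q"
proof (cases "s = t")
  case True
  then show ?thesis using assms by auto
next
  case False
  have "prob {\<omega> \<in> space M. W t \<omega> - W s \<omega> \<in> {y. norm y \<ge> r}}
     \<le> sqrt 2 ^ DIM('a) * fact q * 4 ^ q * ((t - s) / r\<^sup>2) ^ q"
    using assms False by (intro prob_increment_le gaussian_tail) auto
  also have "\<dots> \<le> sqrt 2 ^ DIM('a) * fact q * 4 ^ q * \<eta> ^ q"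
    using assms by (intro mult_left_mono power_mono) auto
  finally show ?thesis .
qed

lemma prob_increment_gap_le:
  assumes "0 \<le> s" "\<delta> \<le> t - s" "t \<le> 1" "\<delta> > 0" "r \<ge> 0"
  shows "prob {\<omega> \<in> space M. W t \<omega> - W s \<omega> \<in> cball w r}
    \<le> unit_ball_vol DIM('a) / sqrt \<delta> ^ DIM('a) * r ^ DIM('a)"
proof (rule prob_increment_le)
  have "gaussian_density (t - s) y \<le> 1 / sqrt \<delta> ^ DIM('a)" for y :: 'a
  proof -
    have "gaussian_density (t - s) y \<le> 1 / sqrt (t - s) ^ DIM('a)"
      using assms by (intro gaussian_density_le) auto
    also have "\<dots> \<le> 1 / sqrt \<delta> ^ DIM('a)"
      using assms by (intro divide_left_mono power_mono) auto
    finally show ?thesis .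
  qed
  then show "(\<integral>\<^sup>+y. ennreal (gaussian_density (t - s) y) * indicator (cball w r) y \<partial>lborel)
    \<le> ennreal (unit_ball_vol DIM('a) / sqrt \<delta> ^ DIM('a) * r ^ DIM('a))"
    using nn_integral_density_cball_le[of w r "gaussian_density (t - s)" "1 / sqrt \<delta> ^ DIM('a)"] assms
    by simp
qed (use assms in auto)

text \<open>The elapsed time enters twice: being at least \<open>\<delta>\<close> it controls the
  exponent, and being at most 1 it controls the normalising factor.\<close>

lemma prob_increment_ge:
  assumes "0 \<le> s" "\<delta> \<le> t - s" "t \<le> 1" "\<delta> > 0" "r \<ge> 0" "norm w + r \<le> R"
  shows "prob {\<omega> \<in> space M. W t \<omega> - W s \<omega> \<in> cball w r}
    \<ge> exp (- R\<^sup>2 / (2 * \<delta>)) / sqrt (2 * pi) ^ DIM('a) * unit_ball_vol DIM('a) * r ^ DIM('a)"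
    (is "_ \<ge> ?L * _ * _")
proof -
  have "gaussian_density (t - s) y \<ge> ?L" if "y \<in> cball w r" for y
  proof -
    have "norm y \<le> R" 
      using that assms norm_triangle_ineq2[of y w] by (auto simp: dist_norm norm_minus_commute)
    then have "(norm y)\<^sup>2 / (2 * (t - s)) \<le> R\<^sup>2 / (2 * \<delta>)"
      using assms by (intro frac_le power_mono) auto
    moreover have "sqrt (2 * pi * (t - s)) ^ DIM('a) \<le> sqrt (2 * pi) ^ DIM('a)"
      using assms by (intro power_mono) (auto simp: mult_le_cancel_left1)
    ultimately show ?thesis
      using assms by (subst gaussian_density_eq) (auto intro!: frac_le)
  qed
  then have "ennreal (?L * unit_ball_vol DIM('a) * r ^ DIM('a))
      \<le> ennreal (prob {\<omega> \<in> space M. W t \<omega> - W s \<omega> \<in> cball w r})"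
    using assms by (subst emeasure_increment) (auto intro!: nn_integral_density_cball_ge simp del: times_divide_eq_left)
  then show ?thesis by (simp add: ennreal_le_iff)
qed

section \<open>Events determined by successive increments\<close>

definition admissible :: "nat \<Rightarrow> (nat \<Rightarrow> real) \<Rightarrow> (nat \<Rightarrow> 'a set) \<Rightarrow> bool" where
  "admissible m \<tau> B \<longleftrightarrow> strict_mono_on {..m} \<tau> \<and> \<tau> ` {..m} \<subseteq> {0..1} \<and> (\<forall>i<m. B i \<in> sets borel)"

definition cylinder :: "nat \<Rightarrow> (nat \<Rightarrow> real) \<Rightarrow> (nat \<Rightarrow> 'a set) \<Rightarrow> 'w set" where
  "cylinder m \<tau> B = {\<omega>\<in>space M. \<forall>i<m. W (\<tau> (Suc i)) \<omega> - W (\<tau> i) \<omega> \<in> B i}"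

lemma admissible_extend:
  assumes "admissible m \<tau> B" "\<tau> m < t" "t \<le> 1" "C \<in> sets borel"
  shows "admissible (Suc m) (\<lambda>i. if i \<le> m then \<tau> i else t) (\<lambda>i. if i < m then B i else C)"
proof -
  have \<tau>: "strict_mono_on {..m} \<tau>" "\<And>i. i \<le> m \<Longrightarrow> \<tau> i \<in> {0..1}"
    using assms(1) unfolding admissible_def by auto
  have less: "\<tau> i < t" if "i \<le> m" for i
    using assms(2) that strict_mono_onD[OF \<tau>(1), of i m] by (cases "i = m") auto
  have "0 \<le> t" using \<tau>(2)[of 0] less[of 0] by auto
  have "strict_mono_on {..Suc m} (\<lambda>i. if i \<le> m then \<tau> i else t)"
    using less strict_mono_onD[OF \<tau>(1)] by (intro strict_mono_onI) auto
  with \<tau>(2) \<open>0 \<le> t\<close> assms show ?thesis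
    unfolding admissible_def by (intro conjI) auto
qed

lemma cylinder_extend:
  "cylinder (Suc m) (\<lambda>i. if i \<le> m then \<tau> i else t) (\<lambda>i. if i < m then B i else C)
    = cylinder m \<tau> B \<inter> {\<omega> \<in> space M. W t \<omega> - W (\<tau> m) \<omega> \<in> C}"
  unfolding cylinder_def by (auto simp: less_Suc_eq)

lemma prob_cylinder:
  assumes "admissible m \<tau> B"
  shows "prob (cylinder m \<tau> B) = (\<Prod>i<m. prob {\<omega>\<in>space M. W (\<tau> (Suc i)) \<omega> - W (\<tau> i) \<omega> \<in> B i})"
proof (cases "m = 0")
  case True
  then show ?thesis by (simp add: prob_space cylinder_def)
next
  case False
  have "prob (\<Inter>i\<in>{..<m}. (\<lambda>\<omega>. W (\<tau> (Suc i)) \<omega> - W (\<tau> i) \<omega>) -` B i \<inter> space M)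
    = (\<Prod>i\<in>{..<m}. prob ((\<lambda>\<omega>. W (\<tau> (Suc i)) \<omega> - W (\<tau> i) \<omega>) -` B i \<inter> space M))"
    using assms False unfolding admissible_def
    by (intro indep_varsD_finite[OF indep_increments]) auto
  moreover have "(\<Inter>i\<in>{..<m}. (\<lambda>\<omega>. W (\<tau> (Suc i)) \<omega> - W (\<tau> i) \<omega>) -` B i \<inter> space M)
    = cylinder m \<tau> B"
    using False by (auto simp: cylinder_def)
  ultimately show ?thesis by (simp add: vimage_def Int_def conj_commute)
qed

text \<open>Consecutive times may coincide here, which spares the estimates below all degenerate cases.\<close>

inductive cyl :: "real \<Rightarrow> 'w set \<Rightarrow> bool" where
  whole: "cyl 0 (space M)"
| step: "cyl s A \<Longrightarrow> s \<le> t \<Longrightarrow> t \<le> 1 \<Longrightarrow> B \<in> sets borel \<Longrightarrow>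
    cyl t (A \<inter> {\<omega> \<in> space M. W t \<omega> - W s \<omega> \<in> B})"

lemma cyl_bounds: "cyl s A \<Longrightarrow> 0 \<le> s \<and> s \<le> 1"
  by (induction rule: cyl.induct) auto

lemma cyl_sets: "cyl s A \<Longrightarrow> A \<in> sets M"
proof (induction rule: cyl.induct)
  case (step s A t B)
  then show ?case using cyl_bounds[OF step.hyps(1)] sets_increment[of s t B] by auto
qed auto

text \<open>Removes repeated times, so that the independence assumption, which needs strictly
  increasing ones, applies. A step with \<open>s = t\<close> tests whether 0 lies in
  \<open>B\<close>, hence keeps the event unchanged or empties it; this is the origin of the first
  alternative.\<close>

lemma cyl_cases:
  assumes "cyl s A"
  shows "A = {} \<or> (\<exists>m \<tau> B. admissible m \<tau> B \<and> \<tau> m = s \<and> A = cylinder m \<tau> B)"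
  using assms
proof induction
  case whole
  have "admissible 0 (\<lambda>_. 0) (\<lambda>_. {})" "cylinder 0 (\<lambda>_. 0) (\<lambda>_. {}) = space M"
    by (auto simp: admissible_def cylinder_def strict_mono_on_def)
  then show ?case by (intro disjI2 exI conjI) (assumption | simp)+
next
  case (step s A t C)
  let ?I = "{\<omega> \<in> space M. W t \<omega> - W s \<omega> \<in> C}"
  consider "A = {}" | "s = t" | m \<tau> B where "s < t" "admissible m \<tau> B" "\<tau> m = s" "A = cylinder m \<tau> B"
    using step.IH step.hyps(2) unfolding le_less by blast
  then show ?case
  proof cases
    case 1
    then show ?thesis by simp
  next
    case 2
    then have "A \<inter> ?I = A \<or> A \<inter> ?I = {}"
      using sets.sets_into_space[OF cyl_sets[OF step.hyps(1)]] by auto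
    then show ?thesis using step.IH 2 by auto
  next
    case 3
    note ext = admissible_extend[OF 3(2), of t C, unfolded 3(3), OF 3(1) step.hyps(3,4)]
    have "A \<inter> ?I = cylinder (Suc m) (\<lambda>i. if i \<le> m then \<tau> i else t) (\<lambda>i. if i < m then B i else C)"
      unfolding cylinder_extend 3(3) 3(4) ..
    with ext show ?thesis
      by (intro disjI2 exI[of _ "Suc m"] exI[of _ "\<lambda>i. if i \<le> m then \<tau> i else t"]
          exI[of _ "\<lambda>i. if i < m then B i else C"] conjI) (assumption | simp)+
  qed
qed

text \<open>The substitute for the Markov property at a fixed time: \<open>A\<close> depends only on
  increments up to \<open>s\<close>, so the next increment is independent of it. For
  \<open>s = t\<close> the increment event is trivial and the product formula still holds.\<close>

lemma prob_cyl_step: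
  assumes A: "cyl s A" and t: "s \<le> t" "t \<le> 1" and C: "C \<in> sets borel"
  shows "prob (A \<inter> {\<omega> \<in> space M. W t \<omega> - W s \<omega> \<in> C})
    = prob A * prob {\<omega> \<in> space M. W t \<omega> - W s \<omega> \<in> C}"
proof -
  let ?I = "{\<omega> \<in> space M. W t \<omega> - W s \<omega> \<in> C}"
  consider "A = {}" | "s = t" | m \<tau> B where "s < t" "admissible m \<tau> B" "\<tau> m = s" "A = cylinder m \<tau> B"
    using cyl_cases[OF A] t(1) unfolding le_less by blast
  then show ?thesis
  proof cases
    case 1
    then show ?thesis by simp
  next
    case 2
    then consider "A \<inter> ?I = A" "?I = space M" | "?I = {}"
      using sets.sets_into_space[OF cyl_sets[OF A]] by auto
    then show ?thesis
    proof cases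
      case 1
      then show ?thesis by (simp only: prob_space mult.right_neutral)
    next
      case 2
      show ?thesis unfolding 2 by simp
    qed
  next
    case 3
    note ext = admissible_extend[OF 3(2), of t C, unfolded 3(3), OF 3(1) t(2) C]
    have "prob (A \<inter> ?I)
      = prob (cylinder (Suc m) (\<lambda>i. if i \<le> m then \<tau> i else t) (\<lambda>i. if i < m then B i else C))"
      unfolding cylinder_extend 3(3) 3(4) ..
    also have "\<dots> = prob (cylinder m \<tau> B) * prob ?I"
      unfolding prob_cylinder[OF ext] prob_cylinder[OF 3(2)] by (simp add: 3(3))
    finally show ?thesis unfolding 3(4) .
  qed
qed

end

section \<open>Grid approximation of visits\<close>

text \<open>The refinement factor 16 comes from chaining: the jumps looked for at level
  \<open>i\<close> shrink like \<open>2 ^ i\<close>, so the time step divided by the squared jump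
  decays like \<open>1 / 4 ^ i\<close>. With a factor 4 this ratio would not decay. A large power of
  it also pays for the \<open>16 ^ i\<close> points of the level.\<close>

definition grid :: "nat \<Rightarrow> nat \<Rightarrow> nat \<Rightarrow> real" where
  "grid N i p = real p / (real N * 16 ^ i)"

definition cell :: "nat \<Rightarrow> nat \<Rightarrow> real \<Rightarrow> nat" where
  "cell N i t = nat \<lfloor>t * (real N * 16 ^ i)\<rfloor>"

lemma grid_cell_le: "0 \<le> t \<Longrightarrow> N > 0 \<Longrightarrow> grid N i (cell N i t) \<le> t"
  by (simp add: grid_def cell_def field_simps)

lemma less_grid_Suc_cell:
  assumes "0 \<le> t" "N > 0"
  shows "t < grid N i (Suc (cell N i t))"
proof -
  have "t * (real N * 16 ^ i) < real (Suc (cell N i t))"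
    unfolding cell_def using assms by simp linarith
  then show ?thesis using assms by (simp add: grid_def field_simps)
qed

text \<open>The cells are nested, so the chaining sequence of \<open>t\<close> is determined by a
  single index \<open>p\<close> at the finest level in use. Union bounds then run over
  \<open>p\<close> instead of over pairs of indices.\<close>

lemma cell_div:
  assumes "0 \<le> t"
  shows "cell N (i + k) t div 16 ^ k = cell N i t"
proof -
  let ?u = "t * (real N * 16 ^ (i + k))"
  have "\<lfloor>?u / real_of_int (16 ^ k)\<rfloor> = \<lfloor>?u\<rfloor> div 16 ^ k"
    by (rule floor_divide_real_eq_div) simp
  moreover have "?u / real_of_int (16 ^ k) = t * (real N * 16 ^ i)"
    by (simp add: power_add)
  ultimately show ?thesis
    using assms by (simp add: cell_def nat_div_distrib nat_power_eq)
qed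

lemma cell_le: "0 \<le> t \<Longrightarrow> t \<le> 1 \<Longrightarrow> cell N i t \<le> N * 16 ^ i"
proof -
  assume t: "0 \<le> t" "t \<le> 1"
  then have "t * (real N * 16 ^ i) \<le> 1 * (real N * 16 ^ i)"
    by (intro mult_right_mono) auto
  then show ?thesis using t unfolding cell_def
    by (simp add: nat_le_iff floor_le_iff)
qed

lemma cell_mono: "s \<le> t \<Longrightarrow> cell N i s \<le> cell N i t"
  unfolding cell_def by (intro nat_mono floor_mono mult_right_mono) auto

lemma card_grid_le:
  assumes "N > 0" "real N * \<epsilon>\<^sup>2 \<le> 2" "0 < \<epsilon>"
  shows "real (card {..N * 16 ^ Suc i}) \<le> 64 / \<epsilon>\<^sup>2 * 16 ^ i"
proof -
  have N: "real N \<le> 2 / \<epsilon>\<^sup>2" using assms by (simp add: field_simps)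
  have "real (card {..N * 16 ^ Suc i}) = real N * 16 ^ Suc i + 1" by simp
  also have "1 \<le> real N * 16 ^ Suc i"
    using assms mult_mono[of 1 "real N" 1 "16 ^ Suc i"] one_le_power[of "16::real" "Suc i"] by simp
  then have "real N * 16 ^ Suc i + 1 \<le> 2 * 16 ^ Suc i * real N" by simp
  also have "\<dots> \<le> 2 * 16 ^ Suc i * (2 / \<epsilon>\<^sup>2)"
    using N by (intro mult_left_mono) auto
  finally show ?thesis by simp
qed

lemma grid_mono: "p \<le> q \<Longrightarrow> grid N i p \<le> grid N i q"
  unfolding grid_def by (intro divide_right_mono) auto

lemma grid_le_1: "p \<le> N * 16 ^ i \<Longrightarrow> N > 0 \<Longrightarrow> grid N i p \<le> 1"
  unfolding grid_def using of_nat_mono[of p "N * 16 ^ i", where 'a = real] by (simp add: divide_le_eq)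

lemma grid_nonneg: "0 \<le> grid N i p"
  unfolding grid_def by simp

lemma grid_div_le:
  assumes "N > 0"
  shows "grid N i (p div 16 ^ k) \<le> grid N (i + k) p"
proof -
  have "real (p div 16 ^ k) \<le> real p / 16 ^ k"
    using of_nat_div_le_of_nat[of p "16 ^ k"] by simp
  then show ?thesis
    using assms by (simp add: grid_def power_add field_simps)
qed

lemma grid_diff_le:
  assumes "N > 0"
  shows "grid N (Suc i) p - grid N i (p div 16) \<le> 1 / (real N * 16 ^ i)"
proof -
  have "real p \<le> 16 * real (p div 16) + 16"
    using of_nat_mono[of p "16 * (p div 16) + 16", where 'a = real] by simp
  then have "real p / 16 - real (p div 16) \<le> 1" by simp
  then have "(real p / 16 - real (p div 16)) / (real N * 16 ^ i) \<le> 1 / (real N * 16 ^ i)"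
    using assms by (intro divide_right_mono) auto
  then show ?thesis by (simp add: grid_def diff_divide_distrib mult.commute mult.left_commute)
qed

lemma grid_cell_tendsto:
  assumes "0 \<le> t" "N > 0"
  shows "(\<lambda>i. grid N i (cell N i t)) \<longlonglongrightarrow> t"
proof -
  have up: "t - 1 / 16 ^ i \<le> grid N i (cell N i t)" for i
  proof -
    have "1 / (real N * 16 ^ i) \<le> 1 / 16 ^ i"
      using assms by (intro divide_left_mono) auto
    moreover have "grid N i (Suc (cell N i t)) = grid N i (cell N i t) + 1 / (real N * 16 ^ i)"
      by (simp add: grid_def add_divide_distrib)
    ultimately show ?thesis using less_grid_Suc_cell[OF assms, of i] by linarith
  qed
  have "(\<lambda>i. (1 / 16) ^ i) \<longlonglongrightarrow> (0::real)"
    by (rule LIMSEQ_realpow_zero) auto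
  then have "(\<lambda>i. t - 1 / 16 ^ i) \<longlonglongrightarrow> t - 0"
    unfolding power_one_over by (rule tendsto_diff[OF tendsto_const])
  then have lim: "(\<lambda>i. t - 1 / 16 ^ i) \<longlonglongrightarrow> t" by simp
  show ?thesis
    by (rule real_tendsto_sandwich[OF _ _ lim tendsto_const])
      (use up grid_cell_le[OF assms] in simp_all)
qed

text \<open>The thresholds \<open>R (1 + 2^-i) / 2\<close> decrease from \<open>R\<close> to \<open>R / 2\<close>, so the distance to \<open>v\<close> along
  the approximations of \<open>t\<close> has to cross one of them.\<close>

lemma chaining_jump:
  fixes f :: "real \<Rightarrow> 'b::real_normed_vector"
  assumes f: "continuous_on {0..1} f" and t: "0 \<le> t" "t \<le> 1" and N: "N > 0" and "R > 0"
    and far: "norm (f (grid N 0 (cell N 0 t)) - v) \<ge> R" and near: "norm (f t - v) < R / 2"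
  obtains i where "norm (f (grid N (Suc i) (cell N (Suc i) t)) - v) \<le> R"
    "norm (f (grid N (Suc i) (cell N (Suc i) t)) - f (grid N i (cell N i t))) \<ge> R / 2 ^ i / 4"
proof -
  define a where "a = (\<lambda>i. f (grid N i (cell N i t)))"
  define b :: "nat \<Rightarrow> real" where "b = (\<lambda>i. (1 + 1 / 2 ^ i) / 2)"
  have mem: "grid N i (cell N i t) \<in> {0..1}" for i
    using grid_nonneg[of N i] grid_cell_le[OF t(1) N, of i] t by (auto intro: order_trans)
  have lim: "a \<longlonglongrightarrow> f t"
    unfolding a_def using f[unfolded continuous_on_sequentially] t mem grid_cell_tendsto[OF t(1) N]
    by (auto simp: o_def)
  have "\<exists>i. norm (a i - v) \<ge> R * b i \<and> norm (a (Suc i) - v) < R * b (Suc i)"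
  proof (rule ccontr)
    assume "\<not> ?thesis"
    then have step: "norm (a i - v) \<ge> R * b i \<Longrightarrow> norm (a (Suc i) - v) \<ge> R * b (Suc i)" for i
      by (meson not_le)
    have all: "norm (a i - v) \<ge> R * b i" for i
      by (induction i) (use far step in \<open>auto simp: a_def b_def\<close>)
    have "R * b i \<ge> R / 2" for i
      using \<open>R > 0\<close> by (simp add: b_def)
    then have "norm (a i - v) \<ge> R / 2" for i
      using all[of i] by (meson order_trans)
    moreover have "(\<lambda>i. norm (a i - v)) \<longlonglongrightarrow> norm (f t - v)"
      by (intro tendsto_intros lim)
    ultimately have "norm (f t - v) \<ge> R / 2"
      by (intro LIMSEQ_le_const) auto
    then show False using near by simp
  qed
  then obtain i where i: "norm (a i - v) \<ge> R * b i" "norm (a (Suc i) - v) < R * b (Suc i)" by blast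
  have "1 / 2 ^ Suc i \<le> (1::real)"
    by (rule divide_le_eq_1_pos[THEN iffD2]) (use one_le_power[of "2::real" "Suc i"] in auto)
  moreover have "(1 + c) / 2 \<le> 1" if "c \<le> 1" for c :: real using that by simp
  ultimately have "b (Suc i) \<le> 1" unfolding b_def by blast
  then have "R * b (Suc i) \<le> R" using \<open>R > 0\<close> by simp
  then have 1: "norm (a (Suc i) - v) \<le> R" using i by linarith
  have "R * b i - R * b (Suc i) = R / 2 ^ i / 4" by (simp add: b_def field_simps)
  moreover have "norm (a i - v) \<le> norm (a (Suc i) - v) + norm (a (Suc i) - a i)"
    using norm_triangle_ineq4[of "a (Suc i) - v" "a (Suc i) - a i"] by simp
  ultimately have 2: "norm (a (Suc i) - a i) \<ge> R / 2 ^ i / 4" using i by linarith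
  from 1 2 show thesis by (intro that) (simp_all only: a_def)
qed

lemma ex_dyadic_radius:
  fixes x :: real
  assumes "x \<ge> 1"
  obtains m where "2 ^ m \<le> x" "x < 2 * 2 ^ m"
proof -
  define k where "k = (LEAST k. x < 2 ^ k)"
  obtain k' where "x < 2 ^ k'" using real_arch_pow[of 2 x] by auto
  then have k: "x < 2 ^ k" unfolding k_def by (rule LeastI)
  then obtain m where m: "k = Suc m" using assms by (cases k) auto
  have "\<not> x < 2 ^ m" using not_less_Least[of m "\<lambda>k. x < 2 ^ k"] m by (simp add: k_def)
  with k m that[of m] show thesis by simp
qed

section \<open>Bounds for outer probability\<close>

context prob_space
begin

text \<open>An outer measure bound: the events to be covered quantify over uncountably many times
  and are not shown to be measurable; only the covering sets have to be.\<close>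

definition small :: "'a set \<Rightarrow> real \<Rightarrow> bool" where
  "small S c \<longleftrightarrow> (\<exists>E\<in>sets M. S \<subseteq> E \<and> prob E \<le> c)"

lemma small_mono: "small T c \<Longrightarrow> S \<subseteq> T \<Longrightarrow> c \<le> c' \<Longrightarrow> small S c'"
  unfolding small_def by (meson order_trans)

lemma small_empty: "0 \<le> c \<Longrightarrow> small {} c"
  unfolding small_def by (intro bexI[of _ "{}"]) auto

lemma small_Un:
  assumes "small S a" "small T b"
  shows "small (S \<union> T) (a + b)"
proof -
  obtain E F where E: "E \<in> sets M" "S \<subseteq> E" "prob E \<le> a" and F: "F \<in> sets M" "T \<subseteq> F" "prob F \<le> b"
    using assms unfolding small_def by blast
  then have "prob (E \<union> F) \<le> a + b"
    using measure_Un_le[of E M F] by linarith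
  with E F show ?thesis unfolding small_def by (intro bexI[of _ "E \<union> F"]) auto
qed

lemma small_UN_finite:
  assumes "finite I" "\<And>i. i \<in> I \<Longrightarrow> small (S i) c"
  shows "small (\<Union>i\<in>I. S i) (real (card I) * c)"
proof -
  have "\<forall>i\<in>I. \<exists>E. E \<in> sets M \<and> S i \<subseteq> E \<and> prob E \<le> c"
    using assms(2) unfolding small_def by blast
  from bchoice[OF this] obtain E where E: "\<And>i. i \<in> I \<Longrightarrow> E i \<in> sets M \<and> S i \<subseteq> E i \<and> prob (E i) \<le> c"
    by blast
  have "prob (\<Union>i\<in>I. E i) \<le> (\<Sum>i\<in>I. prob (E i))"
    using E assms(1) by (intro finite_measure_subadditive_finite) auto
  also have "\<dots> \<le> real (card I) * c"
    using E by (intro sum_bounded_above) auto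
  finally show ?thesis
    unfolding small_def using E assms(1)
    by (intro bexI[of _ "\<Union>i\<in>I. E i"]) (auto intro!: sets.finite_UN)
qed

lemma small_UN_geometric:
  assumes "\<And>m::nat. small (S m) (c * (1 / 2) ^ m)"
  shows "small (\<Union>m. S m) (2 * c)"
proof -
  have "\<forall>m. \<exists>E. E \<in> sets M \<and> S m \<subseteq> E \<and> prob E \<le> c * (1 / 2) ^ m"
    using assms unfolding small_def by blast
  from choice[OF this] obtain E where E: "\<And>m. E m \<in> sets M \<and> S m \<subseteq> E m \<and> prob (E m) \<le> c * (1 / 2) ^ m"
    by blast
  have g: "(\<lambda>m. c * (1 / 2) ^ m) sums (c * 2)"
    using sums_mult[OF geometric_sums[of "1 / 2 :: real"], of c] by simp
  have s: "summable (\<lambda>m. prob (E m))"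
    by (rule summable_comparison_test'[OF sums_summable[OF g], of 0]) (simp add: E)
  have "prob (\<Union>m. E m) \<le> (\<Sum>m. prob (E m))"
    by (rule finite_measure_subadditive_countably) (use E s in blast)+
  also have "\<dots> \<le> (\<Sum>m. c * (1 / 2) ^ m)"
    by (rule suminf_le[OF _ s sums_summable[OF g]]) (simp add: E)
  also have "\<dots> = 2 * c" using sums_unique[OF g] by simp
  finally show ?thesis
    unfolding small_def using E by (intro bexI[of _ "\<Union>m. E m"]) blast+
qed

end

section \<open>Visits in pairwise distinct cells\<close>

context brownian_motion
begin

text \<open>The threshold passed on is the right end of the visited cell, so the next visit falls
  into a later cell. Consequently every approximation of \<open>t\<close> from below inside its
  cell, at any level, is a deterministic time from which the remaining visits may be restarted, and
  the left end of the cell does not precede \<open>s\<close>.\<close>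

primrec hits :: "nat \<Rightarrow> real \<Rightarrow> 'a list \<Rightarrow> real \<Rightarrow> 'w \<Rightarrow> bool" where
  "hits N \<epsilon> [] s \<omega> \<longleftrightarrow> True"
| "hits N \<epsilon> (z # zs) s \<omega> \<longleftrightarrow> (\<exists>t\<in>{0..1}. s \<le> grid N 0 (cell N 0 t) \<and> W t \<omega> \<in> cball z \<epsilon> \<and>
    hits N \<epsilon> zs (grid N 0 (Suc (cell N 0 t))) \<omega>)"

lemma hits_antimono: "hits N \<epsilon> zs s \<omega> \<Longrightarrow> s' \<le> s \<Longrightarrow> hits N \<epsilon> zs s' \<omega>"
  by (cases zs) (auto intro: order_trans)

text \<open>In the second case the left end of the cell is at distance between \<open>R\<close> and
  \<open>2 * R\<close> from \<open>z\<close>, where \<open>R = 4 * 2 ^ m * \<epsilon>\<close>. Then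
  \<open>R / 2 > \<epsilon>\<close>, so chaining finds a jump of size
  \<open>R / 2 ^ i / 4 = 2 ^ m * \<epsilon> / 2 ^ i\<close>. The restart is at the end of this jump
  and not at the left end of the cell, because the jump must belong to the past; there the distance
  to \<open>z\<close> is still at most \<open>R\<close>.\<close>

lemma hits_Cons_cases:
  assumes \<omega>: "\<omega> \<in> space M" and h: "hits N \<epsilon> (z # zs) s \<omega>" and N: "N > 0" and \<epsilon>: "\<epsilon> > 0"
  obtains (near) j where "j \<le> N" "s \<le> grid N 0 j" "norm (W (grid N 0 j) \<omega> - z) \<le> 4 * \<epsilon>"
      "hits N \<epsilon> zs (grid N 0 j) \<omega>"
  | (jump) m i p where "p \<le> N * 16 ^ Suc i" "s \<le> grid N 0 (p div 16 ^ Suc i)"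
      "norm (W (grid N 0 (p div 16 ^ Suc i)) \<omega> - z) \<le> 8 * 2 ^ m * \<epsilon>"
      "norm (W (grid N (Suc i) p) \<omega> - W (grid N i (p div 16)) \<omega>) \<ge> 2 ^ m * \<epsilon> / 2 ^ i"
      "norm (W (grid N (Suc i) p) \<omega> - z) \<le> 4 * 2 ^ m * \<epsilon>"
      "hits N \<epsilon> zs (grid N (Suc i) p) \<omega>"
proof -
  from h obtain t where t: "0 \<le> t" "t \<le> 1" "s \<le> grid N 0 (cell N 0 t)" "W t \<omega> \<in> cball z \<epsilon>"
    and rest: "hits N \<epsilon> zs (grid N 0 (Suc (cell N 0 t))) \<omega>" by auto
  let ?j = "cell N 0 t"
  let ?D = "norm (W (grid N 0 ?j) \<omega> - z)"
  have lt: "t < grid N 0 (Suc ?j)" by (rule less_grid_Suc_cell) (use t N in auto)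
  have le: "grid N i (cell N i t) \<le> t" for i by (rule grid_cell_le) (use t N in auto)
  show thesis
  proof (cases "?D \<le> 4 * \<epsilon>")
    case True
    have "hits N \<epsilon> zs (grid N 0 ?j) \<omega>"
      using rest by (rule hits_antimono) (use lt le[of 0] in linarith)
    moreover have "?j \<le> N" using cell_le[of t N 0] t by simp
    ultimately show thesis using near True t by blast
  next
    case False
    then have "1 \<le> ?D / (4 * \<epsilon>)" using \<epsilon> by (simp add: field_simps)
    then obtain m where m: "2 ^ m \<le> ?D / (4 * \<epsilon>)" "?D / (4 * \<epsilon>) < 2 * 2 ^ m"
      by (rule ex_dyadic_radius)
    have R: "4 * 2 ^ m * \<epsilon> \<le> ?D" "?D \<le> 8 * 2 ^ m * \<epsilon>"
      using m \<epsilon> by (auto simp: field_simps)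
    have "(1::real) \<le> 2 ^ m" by simp
    then have "\<epsilon> * 1 \<le> \<epsilon> * 2 ^ m" using \<epsilon> by (intro mult_left_mono) auto
    moreover have "norm (W t \<omega> - z) \<le> \<epsilon>"
      using t(4) by (simp add: dist_norm norm_minus_commute)
    moreover have "4 * 2 ^ m * \<epsilon> / 2 = 2 * (\<epsilon> * 2 ^ m)" by simp
    ultimately have near': "norm (W t \<omega> - z) < (4 * 2 ^ m * \<epsilon>) / 2"
      using \<epsilon> by linarith
    obtain i where i: "norm (W (grid N (Suc i) (cell N (Suc i) t)) \<omega> - z) \<le> 4 * 2 ^ m * \<epsilon>"
      "norm (W (grid N (Suc i) (cell N (Suc i) t)) \<omega> - W (grid N i (cell N i t)) \<omega>) \<ge> 4 * 2 ^ m * \<epsilon> / 2 ^ i / 4"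
      by (rule chaining_jump[OF continuous_paths[OF \<omega>] t(1,2) N _ R(1) near']) (use \<epsilon> in auto)
    let ?p = "cell N (Suc i) t"
    have c: "?p div 16 ^ Suc i = ?j" "?p div 16 = cell N i t"
      using cell_div[OF t(1), of N 0 "Suc i"] cell_div[OF t(1), of N i 1] by simp_all
    have "hits N \<epsilon> zs (grid N (Suc i) ?p) \<omega>"
      using rest by (rule hits_antimono) (use lt le[of "Suc i"] in linarith)
    moreover have "?p \<le> N * 16 ^ Suc i" using cell_le[of t N "Suc i"] t by simp
    ultimately show thesis
      using jump[of ?p i m] i t R unfolding c by simp
  qed
qed

text \<open>Here \<open>A\<close> is the past up to \<open>s\<close>, \<open>y\<close> the last
  point visited and \<open>r\<close> the accuracy to which \<open>W s\<close> is known. With about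
  \<open>1 / \<epsilon>\<^sup>2\<close> cells and a factor of order \<open>r ^ d\<close> for the
  increment towards the next point, one step costs
  \<open>(r / \<epsilon>) ^ d * \<epsilon> ^ (d - 2)\<close>. A visit detected at scale
  \<open>2 ^ m * \<epsilon>\<close> loses \<open>2 ^ (m * d)\<close> twice, in the target of that
  increment and in the weight of the restart; the exponent \<open>d + 3\<close> of the tail bound
  compensates this together with the number of grid points.\<close>

lemma hits_small:
  assumes N: "1 \<le> real N * \<epsilon>\<^sup>2" "real N * \<epsilon>\<^sup>2 \<le> 2" and \<epsilon>: "0 < \<epsilon>" "\<epsilon> \<le> 1"
    and K1: "\<And>s t w r. 0 \<le> s \<Longrightarrow> s \<le> t \<Longrightarrow> t \<le> 1 \<Longrightarrow> norm w \<ge> \<rho> \<Longrightarrow> r \<ge> 0 \<Longrightarrow>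
      prob {\<omega> \<in> space M. W t \<omega> - W s \<omega> \<in> cball w r} \<le> K1 * r ^ DIM('a)" "K1 \<ge> 0"
    and K2: "\<And>s t r \<eta>. 0 \<le> s \<Longrightarrow> s \<le> t \<Longrightarrow> t \<le> 1 \<Longrightarrow> r > 0 \<Longrightarrow> (t - s) / r\<^sup>2 \<le> \<eta> \<Longrightarrow>
      prob {\<omega> \<in> space M. W t \<omega> - W s \<omega> \<in> {y. norm y \<ge> r}} \<le> K2 * \<eta> ^ (DIM('a) + 3)" "K2 \<ge> 0"
    and d: "DIM('a) \<ge> 2"
    and A: "cyl s A" and zs: "successively (\<lambda>a b. dist a b \<ge> \<rho>) (y # zs)" and r: "r \<ge> \<epsilon>"
  shows "small {\<omega>\<in>A. norm (W s \<omega> - y) \<le> r \<and> hits N \<epsilon> zs s \<omega>}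
    (prob A * (3 * 20 ^ DIM('a) * K1 + 256 * 36 ^ DIM('a) * K1 * K2) ^ length zs
      * (r / \<epsilon>) ^ DIM('a) * (\<epsilon> ^ (DIM('a) - 2)) ^ length zs)"
  using A zs r
proof (induction zs arbitrary: s A y r)
  case Nil
  have "prob A * 1 \<le> prob A * (r / \<epsilon>) ^ DIM('a)"
    using Nil \<epsilon> by (intro mult_left_mono one_le_power) auto
  then show ?case
    unfolding small_def using cyl_sets[OF Nil(1)] by (intro bexI[of _ A]) auto
next
  case (Cons z zs)
  let ?d = "DIM('a)"
  define K0 where "K0 = 3 * 20 ^ ?d * K1 + 256 * 36 ^ ?d * K1 * K2"
  define G where "G = K0 ^ length zs * (\<epsilon> ^ (?d - 2)) ^ length zs"
  have nn: "K0 \<ge> 0" "G \<ge> 0" using K1(2) K2(2) \<epsilon> by (auto simp: K0_def G_def)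
  have r: "0 < r" using Cons.prems \<epsilon> by auto
  have N0: "N > 0" using N by (cases N) auto
  have w: "norm (z - y) \<ge> \<rho>" and zs: "successively (\<lambda>a b. dist a b \<ge> \<rho>) (z # zs)"
    using Cons.prems(2) by (auto simp: dist_norm norm_minus_commute)
  have s0: "0 \<le> s" using cyl_bounds[OF Cons.prems(1)] by simp
  have IH: "small {\<omega>\<in>A'. norm (W s' \<omega> - z) \<le> r' \<and> hits N \<epsilon> zs s' \<omega>} (P * (r' / \<epsilon>) ^ ?d * G)"
    if "cyl s' A'" "r' \<ge> \<epsilon>" "prob A' \<le> P" for s' A' r' P
  proof (rule small_mono[OF Cons.IH[OF that(1) zs that(2)]])
    have "prob A' * ((r' / \<epsilon>) ^ ?d * G) \<le> P * ((r' / \<epsilon>) ^ ?d * G)"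
      using that nn \<epsilon> by (intro mult_right_mono) auto
    then show "prob A' * (3 * 20 ^ ?d * K1 + 256 * 36 ^ ?d * K1 * K2) ^ length zs
      * (r' / \<epsilon>) ^ ?d * (\<epsilon> ^ (?d - 2)) ^ length zs \<le> P * (r' / \<epsilon>) ^ ?d * G"
      by (simp add: G_def K0_def mult_ac)
  qed auto
  define S0 where "S0 j = {\<omega>\<in>A. s \<le> grid N 0 j \<and> norm (W s \<omega> - y) \<le> r
    \<and> norm (W (grid N 0 j) \<omega> - z) \<le> 4 * \<epsilon> \<and> hits N \<epsilon> zs (grid N 0 j) \<omega>}" for j
  define S1 where "S1 m i p = {\<omega>\<in>A. s \<le> grid N 0 (p div 16 ^ Suc i) \<and> norm (W s \<omega> - y) \<le> r
    \<and> norm (W (grid N 0 (p div 16 ^ Suc i)) \<omega> - z) \<le> 8 * 2 ^ m * \<epsilon>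
    \<and> norm (W (grid N (Suc i) p) \<omega> - W (grid N i (p div 16)) \<omega>) \<ge> 2 ^ m * \<epsilon> / 2 ^ i
    \<and> norm (W (grid N (Suc i) p) \<omega> - z) \<le> 4 * 2 ^ m * \<epsilon> \<and> hits N \<epsilon> zs (grid N (Suc i) p) \<omega>}" for m i p
  have A_space: "A \<subseteq> space M" using sets.sets_into_space[OF cyl_sets[OF Cons.prems(1)]] .
  have cover: "{\<omega>\<in>A. norm (W s \<omega> - y) \<le> r \<and> hits N \<epsilon> (z # zs) s \<omega>}
    \<subseteq> (\<Union>j\<in>{..N}. S0 j) \<union> (\<Union>m. \<Union>i. \<Union>p\<in>{..N * 16 ^ Suc i}. S1 m i p)"
  proof
    fix \<omega> assume *: "\<omega> \<in> {\<omega>\<in>A. norm (W s \<omega> - y) \<le> r \<and> hits N \<epsilon> (z # zs) s \<omega>}"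
    then have h: "hits N \<epsilon> (z # zs) s \<omega>" and "\<omega> \<in> space M" using A_space by auto
    from \<open>\<omega> \<in> space M\<close> h N0 \<epsilon>(1)
    show "\<omega> \<in> (\<Union>j\<in>{..N}. S0 j) \<union> (\<Union>m. \<Union>i. \<Union>p\<in>{..N * 16 ^ Suc i}. S1 m i p)"
    proof (cases rule: hits_Cons_cases)
      case (near j)
      then have "\<omega> \<in> S0 j" using * unfolding S0_def by blast
      then show ?thesis using near by blast
    next
      case (jump m i p)
      then have "\<omega> \<in> S1 m i p" using * unfolding S1_def by blast
      then show ?thesis using jump(1) by blast
    qed
  qed
  \<comment> \<open>Positions become increments: the errors at both ends add up, and the centre
    \<open>z - y\<close> has norm at least \<open>\<rho>\<close>, as the bound \<open>K1\<close>
    requires.\<close>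
  have first_step: "\<omega> \<in> A \<inter> {\<omega>\<in>space M. W u \<omega> - W s \<omega> \<in> cball (z - y) (r + b)}"
    if "\<omega> \<in> A" "norm (W s \<omega> - y) \<le> r" "norm (W u \<omega> - z) \<le> b" for \<omega> u b
  proof -
    have "norm ((z - y) - (W u \<omega> - W s \<omega>)) \<le> norm (W s \<omega> - y) + norm (W u \<omega> - z)"
      using norm_triangle_ineq4[of "W s \<omega> - y" "W u \<omega> - z"] by (simp add: algebra_simps)
    then show ?thesis using that A_space by (auto simp: dist_norm)
  qed
  \<comment> \<open>The 20 is 5 times 4: the target radius is
    \<open>r + 4 * \<epsilon> \<le> 5 * r\<close>, and restarting with accuracy
    \<open>4 * \<epsilon>\<close> has weight \<open>4 ^ ?d\<close>.\<close>
  have 0: "small (S0 j) (prob A * K1 * 20 ^ ?d * r ^ ?d * G)" if "j \<le> N" for j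
  proof (cases "s \<le> grid N 0 j")
    case True
    let ?u = "grid N 0 j"
    let ?A = "A \<inter> {\<omega>\<in>space M. W ?u \<omega> - W s \<omega> \<in> cball (z - y) (r + 4 * \<epsilon>)}"
    have u: "?u \<le> 1" using grid_le_1[of j N 0] that N0 by simp
    have cyl: "cyl ?u ?A" using True u by (intro cyl.step Cons.prems) auto
    have "prob ?A = prob A * prob {\<omega>\<in>space M. W ?u \<omega> - W s \<omega> \<in> cball (z - y) (r + 4 * \<epsilon>)}"
      using True u by (intro prob_cyl_step Cons.prems) auto
    also have "\<dots> \<le> prob A * (K1 * (r + 4 * \<epsilon>) ^ ?d)"
      using True u w s0 r \<epsilon> by (intro mult_left_mono K1) auto
    also have "\<dots> \<le> prob A * (K1 * (5 * r) ^ ?d)"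
      using Cons.prems(3) r \<epsilon> K1(2) by (intro mult_left_mono power_mono) auto
    finally have P: "prob ?A \<le> prob A * (K1 * (5 * r) ^ ?d)" .
    have "small (S0 j) (prob A * (K1 * (5 * r) ^ ?d) * (4 * \<epsilon> / \<epsilon>) ^ ?d * G)"
      by (rule small_mono[OF IH[of _ _ "4 * \<epsilon>", OF cyl _ P]]) (use first_step \<epsilon> in \<open>auto simp: S0_def\<close>)
    moreover have "(20::real) ^ ?d = 5 ^ ?d * 4 ^ ?d" by (simp flip: power_mult_distrib)
    ultimately show ?thesis using \<epsilon> by (simp add: power_mult_distrib mult_ac)
  next
    case False
    then have "S0 j = {}" by (auto simp: S0_def)
    then show ?thesis using small_empty nn K1 r by (simp add: zero_le_mult_iff)
  qed
  \<comment> \<open>The 36 is 9 times 4: the target radius is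
    \<open>r + 8 * 2 ^ m * \<epsilon> \<le> 9 * 2 ^ m * r\<close>, and the restart has accuracy
    \<open>4 * 2 ^ m * \<epsilon>\<close>. The two powers of \<open>2 ^ m\<close> combine to
    \<open>4 ^ (m * ?d)\<close>.\<close>
  have 1: "small (S1 m i p) (prob A * K1 * K2 * 36 ^ ?d * r ^ ?d * G * (4 ^ (m * ?d) * (1 / 4 ^ (m + i)) ^ (?d + 3)))"
    if "p \<le> N * 16 ^ Suc i" for m i p
  proof (cases "s \<le> grid N 0 (p div 16 ^ Suc i)")
    case True
    let ?u = "grid N 0 (p div 16 ^ Suc i)"
    let ?a = "grid N i (p div 16)"
    let ?b = "grid N (Suc i) p"
    let ?A1 = "A \<inter> {\<omega>\<in>space M. W ?u \<omega> - W s \<omega> \<in> cball (z - y) (r + 8 * 2 ^ m * \<epsilon>)}"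
    \<comment> \<open>An unconstrained increment, which only moves the end time of the cylinder from
      \<open>?u\<close> to \<open>?a\<close>, where the jump begins.\<close>
    let ?A2 = "?A1 \<inter> {\<omega>\<in>space M. W ?a \<omega> - W ?u \<omega> \<in> UNIV}"
    let ?J = "{\<omega>\<in>space M. W ?b \<omega> - W ?a \<omega> \<in> {y. norm y \<ge> 2 ^ m * \<epsilon> / 2 ^ i}}"
    have "?u \<le> ?a" using grid_div_le[OF N0, of 0 "p div 16" i] by (simp add: div_mult2_eq)
    moreover have "?a \<le> ?b" using grid_div_le[OF N0, of i p 1] by simp
    moreover have "?b \<le> 1" using grid_le_1[OF that N0] .
    ultimately have le: "?u \<le> ?a" "?a \<le> ?b" "?b \<le> 1" "?u \<le> 1" "?a \<le> 1" by linarith+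
    have cyl1: "cyl ?u ?A1" using True le by (intro cyl.step Cons.prems) auto
    have cyl2: "cyl ?a ?A2" by (rule cyl.step[OF cyl1]) (use le in auto)
    have cyl3: "cyl ?b (?A2 \<inter> ?J)" by (rule cyl.step[OF cyl2]) (use le in auto)
    have A12: "?A2 = ?A1" by auto
    have J: "{y::'a. norm y \<ge> 2 ^ m * \<epsilon> / 2 ^ i} \<in> sets borel" by measurable
    have eta: "(?b - ?a) / (2 ^ m * \<epsilon> / 2 ^ i)\<^sup>2 \<le> 1 / 4 ^ (m + i)"
    proof -
      have "(?b - ?a) / (2 ^ m * \<epsilon> / 2 ^ i)\<^sup>2 \<le> (1 / (real N * 16 ^ i)) / (2 ^ m * \<epsilon> / 2 ^ i)\<^sup>2"
        by (intro divide_right_mono grid_diff_le N0) auto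
      also have "\<dots> = 1 / (real N * \<epsilon>\<^sup>2) * (1 / 4 ^ (m + i))"
      proof -
        have e: "(2 ^ i)\<^sup>2 = (4::real) ^ i" "(2 ^ m)\<^sup>2 = (4::real) ^ m" "(16::real) ^ i = 4 ^ i * 4 ^ i"
          by (simp_all add: power2_eq_square flip: power_mult_distrib)
        show ?thesis using N0 \<epsilon> unfolding power_divide power_mult_distrib e power_add
          by (simp add: field_simps)
      qed
      also have "\<dots> \<le> 1 * (1 / 4 ^ (m + i))"
        using N by (intro mult_right_mono) auto
      finally show ?thesis by simp
    qed
    have "prob (?A2 \<inter> ?J) = prob ?A1 * prob ?J"
      by (subst prob_cyl_step[OF cyl2 le(2,3)]) (auto simp only: A12 J)
    also have "prob ?A1 = prob A * prob {\<omega>\<in>space M. W ?u \<omega> - W s \<omega> \<in> cball (z - y) (r + 8 * 2 ^ m * \<epsilon>)}"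
      using True le by (intro prob_cyl_step Cons.prems) auto
    also have "\<dots> * prob ?J \<le> prob A * (K1 * (r + 8 * 2 ^ m * \<epsilon>) ^ ?d) * (K2 * (1 / 4 ^ (m + i)) ^ (?d + 3))"
    proof (intro mult_mono mult_left_mono)
      show "prob {\<omega>\<in>space M. W ?u \<omega> - W s \<omega> \<in> cball (z - y) (r + 8 * 2 ^ m * \<epsilon>)} \<le> K1 * (r + 8 * 2 ^ m * \<epsilon>) ^ ?d"
        using True le w s0 r \<epsilon> by (intro K1) auto
      show "prob ?J \<le> K2 * (1 / 4 ^ (m + i)) ^ (?d + 3)"
        using le grid_nonneg eta \<epsilon> by (intro K2) auto
    qed (use K1 r \<epsilon> in auto)
    also have "\<dots> \<le> prob A * (K1 * (9 * 2 ^ m * r) ^ ?d) * (K2 * (1 / 4 ^ (m + i)) ^ (?d + 3))"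
    proof -
      have "1 * r \<le> 2 ^ m * r" "2 ^ m * \<epsilon> \<le> 2 ^ m * r"
        using r Cons.prems(3) by (auto intro!: mult_right_mono)
      then have "r + 8 * 2 ^ m * \<epsilon> \<le> 9 * 2 ^ m * r" by linarith
      then show ?thesis
        using r \<epsilon> K1(2) K2(2) by (intro mult_right_mono mult_left_mono power_mono) auto
    qed
    finally have P: "prob (?A2 \<inter> ?J) \<le> prob A * (K1 * (9 * 2 ^ m * r) ^ ?d) * (K2 * (1 / 4 ^ (m + i)) ^ (?d + 3))" .
    have rr: "\<epsilon> \<le> 4 * 2 ^ m * \<epsilon>"
    proof -
      have "1 * \<epsilon> \<le> (4 * 2 ^ m) * \<epsilon>"
      proof (rule mult_right_mono)
        have "(1::real) \<le> 2 ^ m" by simp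
        then show "(1::real) \<le> 4 * 2 ^ m" by linarith
      qed (use \<epsilon> in auto)
      then show ?thesis by simp
    qed
    have "small (S1 m i p) (prob A * (K1 * (9 * 2 ^ m * r) ^ ?d) * (K2 * (1 / 4 ^ (m + i)) ^ (?d + 3))
        * (4 * 2 ^ m * \<epsilon> / \<epsilon>) ^ ?d * G)"
    proof (rule small_mono[OF IH[OF cyl3 rr P]])
      show "S1 m i p \<subseteq> {\<omega> \<in> ?A2 \<inter> ?J. norm (W ?b \<omega> - z) \<le> 4 * 2 ^ m * \<epsilon> \<and> hits N \<epsilon> zs ?b \<omega>}"
      proof
        fix \<omega> assume *: "\<omega> \<in> S1 m i p"
        then have "\<omega> \<in> ?A1" by (intro first_step) (auto simp: S1_def)
        with * show "\<omega> \<in> {\<omega> \<in> ?A2 \<inter> ?J. norm (W ?b \<omega> - z) \<le> 4 * 2 ^ m * \<epsilon> \<and> hits N \<epsilon> zs ?b \<omega>}"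
          unfolding A12 by (auto simp: S1_def)
      qed
    qed simp
    also have "prob A * (K1 * (9 * 2 ^ m * r) ^ ?d) * (K2 * (1 / 4 ^ (m + i)) ^ (?d + 3))
        * (4 * 2 ^ m * \<epsilon> / \<epsilon>) ^ ?d * G
      = prob A * K1 * K2 * 36 ^ ?d * r ^ ?d * G * (4 ^ (m * ?d) * (1 / 4 ^ (m + i)) ^ (?d + 3))"
    proof -
      have e4: "(2::real) ^ m * 2 ^ m = 4 ^ m" by (simp flip: power_mult_distrib)
      have e: "(9 * X * r) * (4 * X * \<epsilon> / \<epsilon>) = 36 * (X * X) * r" for X
        using \<epsilon> by simp
      have "(9 * 2 ^ m * r) ^ ?d * (4 * 2 ^ m * \<epsilon> / \<epsilon>) ^ ?d = (36 * (2 ^ m * 2 ^ m) * r) ^ ?d"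
        by (simp only: power_mult_distrib[symmetric] e)
      also have "\<dots> = 36 ^ ?d * 4 ^ (m * ?d) * r ^ ?d"
        unfolding e4 by (simp add: power_mult_distrib power_mult)
      finally have "(9 * 2 ^ m * r) ^ ?d * (4 * 2 ^ m * \<epsilon> / \<epsilon>) ^ ?d = 36 ^ ?d * 4 ^ (m * ?d) * r ^ ?d" .
      note XY = this
      have "prob A * (K1 * X) * (K2 * c) * Y * G = prob A * K1 * K2 * Z1 * Z3 * G * (Z2 * c)"
        if "X * Y = Z1 * Z2 * Z3" for X Y Z1 Z2 Z3 c
      proof -
        have "prob A * (K1 * X) * (K2 * c) * Y * G = prob A * K1 * K2 * G * c * (X * Y)"
          by (simp only: mult_ac)
        also have "\<dots> = prob A * K1 * K2 * Z1 * Z3 * G * (Z2 * c)"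
          unfolding that by (simp only: mult_ac)
        finally show ?thesis .
      qed
      from this[OF XY] show ?thesis .
    qed
    finally show ?thesis .
  next
    case False
    then have "S1 m i p = {}" by (auto simp: S1_def)
    then show ?thesis using nn K1 K2 r by (auto intro!: small_empty mult_nonneg_nonneg)
  qed
  have N1: "real N \<le> 2 / \<epsilon>\<^sup>2" "1 \<le> 1 / \<epsilon>\<^sup>2"
    using N \<epsilon> by (auto simp: field_simps power_le_one)
  have U0: "small (\<Union>j\<in>{..N}. S0 j) (3 / \<epsilon>\<^sup>2 * (prob A * K1 * 20 ^ ?d * r ^ ?d * G))"
  proof (rule small_mono[OF small_UN_finite])
    show "real (card {..N}) * (prob A * K1 * 20 ^ ?d * r ^ ?d * G)
      \<le> 3 / \<epsilon>\<^sup>2 * (prob A * K1 * 20 ^ ?d * r ^ ?d * G)"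
      using N1 nn K1 r by (intro mult_right_mono mult_nonneg_nonneg) auto
  qed (use 0 in auto)
  define Q where "Q = prob A * K1 * K2 * 36 ^ ?d * r ^ ?d * G"
  have Q: "Q \<ge> 0" using nn K1 K2 r by (auto simp: Q_def)
  have U1: "small (\<Union>p\<in>{..N * 16 ^ Suc i}. S1 m i p) (64 / \<epsilon>\<^sup>2 * Q * (1 / 2) ^ m * (1 / 2) ^ i)" for m i
  proof (rule small_mono[OF small_UN_finite])
    let ?c = "Q * (4 ^ (m * ?d) * (1 / 4 ^ (m + i)) ^ (?d + 3))"
    have c: "real (card {..N * 16 ^ Suc i}) \<le> 64 / \<epsilon>\<^sup>2 * 16 ^ i"
      by (rule card_grid_le) (use N0 N \<epsilon> in auto)
    \<comment> \<open>Powers of 4: \<open>m\<close> occurs with exponent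
      \<open>?d - (?d + 3) = -3\<close> and \<open>i\<close> with exponent
      \<open>2 - (?d + 3)\<close>, so both series are dominated by geometric ones of ratio 1/2.
      Summing them turns 64 into 256.\<close>
    have e: "16 ^ i * (4 ^ (m * ?d) * (1 / 4 ^ (m + i)) ^ (?d + 3)) \<le> (1 / 2 :: real) ^ m * (1 / 2) ^ i"
    proof -
      have "(2::real) ^ (4 * i) = 16 ^ i" "(2::real) ^ (2 * (m * ?d)) = 4 ^ (m * ?d)"
        by (simp_all add: power_mult)
      then have "(16::real) ^ i * 4 ^ (m * ?d) * 2 ^ m * 2 ^ i = 2 ^ (4 * i + 2 * (m * ?d) + m + i)"
        by (simp only: power_add)
      also have "\<dots> \<le> 2 ^ (2 * ((m + i) * (?d + 3)))"
      proof (rule power_increasing)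
        have "i * 5 \<le> i * (2 * (?d + 3))" by (intro mult_left_mono) auto
        then show "4 * i + 2 * (m * ?d) + m + i \<le> 2 * ((m + i) * (?d + 3))"
          by (simp add: algebra_simps)
      qed simp
      also have "\<dots> = (4 ^ (m + i)) ^ (?d + 3)"
        by (simp add: power_mult)
      finally show ?thesis by (simp add: power_divide field_simps)
    qed
    have "real (card {..N * 16 ^ Suc i}) * ?c \<le> 64 / \<epsilon>\<^sup>2 * 16 ^ i * ?c"
      using c Q by (intro mult_right_mono) auto
    also have "\<dots> = 64 / \<epsilon>\<^sup>2 * Q * (16 ^ i * (4 ^ (m * ?d) * (1 / 4 ^ (m + i)) ^ (?d + 3)))"
      by simp
    also have "\<dots> \<le> 64 / \<epsilon>\<^sup>2 * Q * ((1 / 2) ^ m * (1 / 2) ^ i)"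
      using Q by (intro mult_left_mono e) auto
    finally show "real (card {..N * 16 ^ Suc i}) * ?c \<le> 64 / \<epsilon>\<^sup>2 * Q * (1 / 2) ^ m * (1 / 2) ^ i"
      by (simp add: mult.assoc)
  qed (use 1 in \<open>auto simp: Q_def\<close>)
  have U2: "small (\<Union>i. \<Union>p\<in>{..N * 16 ^ Suc i}. S1 m i p) (128 / \<epsilon>\<^sup>2 * Q * (1 / 2) ^ m)" for m
    using small_UN_geometric[OF U1, of m] by (simp add: mult.assoc)
  have U3: "small (\<Union>m. \<Union>i. \<Union>p\<in>{..N * 16 ^ Suc i}. S1 m i p) (256 / \<epsilon>\<^sup>2 * Q)"
    using small_UN_geometric[OF U2] by simp
  show ?case
  proof (rule small_mono[OF small_Un[OF U0 U3] cover])
    have "\<epsilon> ^ ?d = \<epsilon>\<^sup>2 * \<epsilon> ^ (?d - 2)" 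
      using power_add[of \<epsilon> 2 "?d - 2"] by (simp only: le_add_diff_inverse[OF d])
    then have e: "r ^ ?d / \<epsilon>\<^sup>2 = (r / \<epsilon>) ^ ?d * \<epsilon> ^ (?d - 2)"
      using \<epsilon> by (simp add: power_divide)
    have "prob A * K0 ^ length (z # zs) * (r / \<epsilon>) ^ ?d * (\<epsilon> ^ (?d - 2)) ^ length (z # zs)
      = prob A * K0 * G * (r ^ ?d / \<epsilon>\<^sup>2)"
      unfolding e by (simp add: G_def mult_ac)
    also have "\<dots> = 3 / \<epsilon>\<^sup>2 * (prob A * K1 * 20 ^ ?d * r ^ ?d * G) + 256 / \<epsilon>\<^sup>2 * Q"
      by (simp add: K0_def Q_def algebra_simps add_divide_distrib)
    finally show "3 / \<epsilon>\<^sup>2 * (prob A * K1 * 20 ^ ?d * r ^ ?d * G) + 256 / \<epsilon>\<^sup>2 * Q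
      \<le> prob A * (3 * 20 ^ ?d * K1 + 256 * 36 ^ ?d * K1 * K2) ^ length (z # zs)
        * (r / \<epsilon>) ^ ?d * (\<epsilon> ^ (?d - 2)) ^ length (z # zs)"
      by (simp only: K0_def)
  qed
qed

end

section \<open>Ordered visits and their measurability\<close>

context brownian_motion
begin

definition cell_jump :: "nat \<Rightarrow> real \<Rightarrow> 'w set" where
  "cell_jump N \<delta> = {\<omega>\<in>space M. \<exists>t\<in>{0..1}. norm (W t \<omega> - W (grid N 0 (cell N 0 t)) \<omega>) \<ge> \<delta>}"

text \<open>Since \<open>q\<close> is free, an oscillation of fixed size within a cell is rarer than
  any prescribed power of \<open>\<epsilon>\<close>. The condition \<open>q \<ge> 3\<close> makes
  \<open>16 ^ i * (1 / 4 ^ i) ^ q\<close> summable over the levels.\<close>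

lemma cell_jump_small:
  assumes N: "1 \<le> real N * \<epsilon>\<^sup>2" "real N * \<epsilon>\<^sup>2 \<le> 2" and \<epsilon>: "0 < \<epsilon>" "\<epsilon> \<le> 1"
    and T: "\<And>s t r \<eta>. 0 \<le> s \<Longrightarrow> s \<le> t \<Longrightarrow> t \<le> 1 \<Longrightarrow> r > 0 \<Longrightarrow> (t - s) / r\<^sup>2 \<le> \<eta> \<Longrightarrow>
      prob {\<omega> \<in> space M. W t \<omega> - W s \<omega> \<in> {y. norm y \<ge> r}} \<le> T * \<eta> ^ q" "T \<ge> 0"
    and q: "q \<ge> 3" and \<delta>: "\<delta> > 0"
  shows "small (cell_jump N \<delta>) (128 * T * (16 * \<epsilon>\<^sup>2 / \<delta>\<^sup>2) ^ q / \<epsilon>\<^sup>2)"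
proof -
  have N0: "N > 0" using N by (cases N) auto
  define S where "S i p = {\<omega>\<in>space M. W (grid N (Suc i) p) \<omega> - W (grid N i (p div 16)) \<omega>
    \<in> {y. norm y \<ge> \<delta> / 2 ^ i / 4}}" for i p
  define E where "E = T * (16 * \<epsilon>\<^sup>2 / \<delta>\<^sup>2) ^ q"
  have E: "E \<ge> 0" using T(2) by (simp add: E_def)
  have "cell_jump N \<delta> \<subseteq> (\<Union>i. \<Union>p\<in>{..N * 16 ^ Suc i}. S i p)"
  proof
    fix \<omega> assume "\<omega> \<in> cell_jump N \<delta>"
    then obtain t where \<omega>: "\<omega> \<in> space M" and t: "0 \<le> t" "t \<le> 1"
      and far: "\<delta> \<le> norm (W (grid N 0 (cell N 0 t)) \<omega> - W t \<omega>)"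
      by (auto simp: cell_jump_def norm_minus_commute)
    \<comment> \<open>The centre for the chaining is \<open>W t \<omega>\<close> itself, so the
      condition of being near at time \<open>t\<close> reads
      \<open>0 < \<delta> / 2\<close>.\<close>
    obtain i where i: "norm (W (grid N (Suc i) (cell N (Suc i) t)) \<omega> - W (grid N i (cell N i t)) \<omega>) \<ge> \<delta> / 2 ^ i / 4"
      by (rule chaining_jump[OF continuous_paths[OF \<omega>] t N0 \<delta> far]) (use \<delta> in auto)
    let ?p = "cell N (Suc i) t"
    have "?p div 16 = cell N i t" using cell_div[OF t(1), of N i 1] by simp
    with i \<omega> have "\<omega> \<in> S i ?p" unfolding S_def by simp
    moreover have "?p \<le> N * 16 ^ Suc i" by (rule cell_le[OF t])
    ultimately show "\<omega> \<in> (\<Union>i. \<Union>p\<in>{..N * 16 ^ Suc i}. S i p)" by blast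
  qed
  moreover have S: "small (S i p) (E * (1 / 4 ^ i) ^ q)" if p: "p \<le> N * 16 ^ Suc i" for i p
  proof -
    have le: "grid N i (p div 16) \<le> grid N (Suc i) p" "grid N (Suc i) p \<le> 1"
      using grid_div_le[OF N0, of i p 1] grid_le_1[OF p N0] by auto
    have eta: "(grid N (Suc i) p - grid N i (p div 16)) / (\<delta> / 2 ^ i / 4)\<^sup>2 \<le> 16 * \<epsilon>\<^sup>2 / \<delta>\<^sup>2 * (1 / 4 ^ i)"
    proof -
      have e: "(2 ^ i)\<^sup>2 = (4::real) ^ i" "(16::real) ^ i = 4 ^ i * 4 ^ i"
        by (simp_all add: power2_eq_square flip: power_mult_distrib)
      have "1 / real N \<le> \<epsilon>\<^sup>2" using N N0 by (simp add: field_simps)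
      then have "1 / real N * (16 / \<delta>\<^sup>2 * (1 / 4 ^ i)) \<le> \<epsilon>\<^sup>2 * (16 / \<delta>\<^sup>2 * (1 / 4 ^ i))"
        by (intro mult_right_mono) auto
      moreover have "1 / real N * (16 / \<delta>\<^sup>2 * (1 / 4 ^ i)) = (1 / (real N * 16 ^ i)) / (\<delta> / 2 ^ i / 4)\<^sup>2"
        unfolding power_divide e using \<delta> N0 by (simp add: field_simps)
      moreover have "(grid N (Suc i) p - grid N i (p div 16)) / (\<delta> / 2 ^ i / 4)\<^sup>2
          \<le> (1 / (real N * 16 ^ i)) / (\<delta> / 2 ^ i / 4)\<^sup>2"
        by (intro divide_right_mono grid_diff_le N0) auto
      moreover have "\<epsilon>\<^sup>2 * (16 / \<delta>\<^sup>2 * (1 / 4 ^ i)) = 16 * \<epsilon>\<^sup>2 / \<delta>\<^sup>2 * (1 / 4 ^ i)"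
        by (simp add: field_simps)
      ultimately show ?thesis by linarith
    qed
    have "prob (S i p) \<le> T * (16 * \<epsilon>\<^sup>2 / \<delta>\<^sup>2 * (1 / 4 ^ i)) ^ q"
      unfolding S_def using le grid_nonneg \<delta> eta by (intro T) auto
    also have "\<dots> = E * (1 / 4 ^ i) ^ q"
      unfolding E_def power_mult_distrib[of "16 * \<epsilon>\<^sup>2 / \<delta>\<^sup>2"] by simp
    finally have "prob (S i p) \<le> E * (1 / 4 ^ i) ^ q" .
    moreover have "S i p \<in> sets M"
      unfolding S_def using le grid_nonneg by (intro sets_increment) (auto intro: order_trans)
    ultimately show ?thesis unfolding small_def by blast
  qed
  have U: "small (\<Union>p\<in>{..N * 16 ^ Suc i}. S i p) (64 / \<epsilon>\<^sup>2 * E * (1 / 2) ^ i)" for i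
  proof (rule small_mono[OF small_UN_finite])
    have "real (card {..N * 16 ^ Suc i}) * (E * (1 / 4 ^ i) ^ q) \<le> 64 / \<epsilon>\<^sup>2 * 16 ^ i * (E * (1 / 4 ^ i) ^ q)"
      using E N N0 \<epsilon> by (intro mult_right_mono card_grid_le) auto
    also have "\<dots> = 64 / \<epsilon>\<^sup>2 * E * (16 ^ i * (1 / 4 ^ i) ^ q)" by simp
    also have "\<dots> \<le> 64 / \<epsilon>\<^sup>2 * E * (16 ^ i * (1 / 4 ^ i) ^ 3)"
      using E q by (intro mult_left_mono power_decreasing) auto
    also have "(1 / 4 ^ i) ^ 3 = (1 / 64 :: real) ^ i"
      using power_mult[of "4::real" i 3] power_mult[of "4::real" 3 i] by (simp add: power_divide mult.commute)
    also have "16 ^ i * (1 / 64) ^ i = (1 / 4 :: real) ^ i"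
      by (simp flip: power_mult_distrib)
    also have "64 / \<epsilon>\<^sup>2 * E * (1 / 4) ^ i \<le> 64 / \<epsilon>\<^sup>2 * E * (1 / 2) ^ i"
      using E by (intro mult_left_mono power_mono) auto
    finally show "real (card {..N * 16 ^ Suc i}) * (E * (1 / 4 ^ i) ^ q) \<le> 64 / \<epsilon>\<^sup>2 * E * (1 / 2) ^ i" .
  qed (use S in auto)
  ultimately have "small (cell_jump N \<delta>) (2 * (64 / \<epsilon>\<^sup>2 * E))"
    by (intro small_mono[OF small_UN_geometric[OF U]]) auto
  then show ?thesis by (simp add: E_def mult.assoc)
qed

text \<open>The times are only weakly ordered, which keeps the condition closed under limits;
  strictness is recovered in \<open>reach_iff\<close>.\<close>

primrec reach :: "real \<Rightarrow> 'a list \<Rightarrow> real \<Rightarrow> 'w \<Rightarrow> bool" where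
  "reach \<epsilon> [] s \<omega> \<longleftrightarrow> True"
| "reach \<epsilon> (z # zs) s \<omega> \<longleftrightarrow> (\<exists>t\<in>{s..1}. W t \<omega> \<in> cball z \<epsilon> \<and> reach \<epsilon> zs t \<omega>)"

lemma reach_antimono: "reach \<epsilon> zs s \<omega> \<Longrightarrow> s' \<le> s \<Longrightarrow> reach \<epsilon> zs s' \<omega>"
  by (cases zs) (auto intro: order_trans)

text \<open>Two successive visits in one cell would both be within \<open>\<rho> / 4\<close> of the
  path at its left end, so their centres would be closer than
  \<open>2 * \<epsilon> + \<rho> / 2 \<le> \<rho>\<close>, contrary to separation. Distinct cells
  are ordered like the visits.\<close>

lemma reach_imp_hits_tail:
  assumes "\<omega> \<in> space M" "\<omega> \<notin> cell_jump N (\<rho> / 4)" "4 * \<epsilon> \<le> \<rho>"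
    and "successively (\<lambda>a b. dist a b \<ge> \<rho>) (z # zs)"
    and "0 \<le> s" "s \<le> 1" "W s \<omega> \<in> cball z \<epsilon>" "reach \<epsilon> zs s \<omega>"
  shows "hits N \<epsilon> zs (grid N 0 (Suc (cell N 0 s))) \<omega>"
  using assms(4-8)
proof (induction zs arbitrary: z s)
  case (Cons z' zs)
  from Cons.prems obtain t where t: "s \<le> t" "t \<le> 1" "W t \<omega> \<in> cball z' \<epsilon>" "reach \<epsilon> zs t \<omega>"
    by auto
  have near: "norm (W u \<omega> - W (grid N 0 (cell N 0 u)) \<omega>) < \<rho> / 4" if "u \<in> {0..1}" for u
    using assms(1,2) that unfolding cell_jump_def by (auto simp: not_le)
  have "cell N 0 s \<noteq> cell N 0 t"
  proof
    assume eq: "cell N 0 s = cell N 0 t"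
    have "dist (W s \<omega>) (W t \<omega>) < \<rho> / 2"
      using near[of s] near[of t] Cons.prems t unfolding eq dist_norm
      using norm_triangle_ineq4[of "W s \<omega> - W (grid N 0 (cell N 0 t)) \<omega>" "W t \<omega> - W (grid N 0 (cell N 0 t)) \<omega>"]
      by simp
    moreover have "dist z z' \<le> dist z (W s \<omega>) + dist (W s \<omega>) (W t \<omega>) + dist z' (W t \<omega>)"
      by (metis dist_commute dist_triangle2 add_mono_thms_linordered_semiring(3) order_trans)
    ultimately show False
      using Cons.prems(1,4) t(3) assms(3) by auto
  qed
  then have "Suc (cell N 0 s) \<le> cell N 0 t"
    using cell_mono[OF t(1), of N 0] by simp
  then have "grid N 0 (Suc (cell N 0 s)) \<le> grid N 0 (cell N 0 t)" by (rule grid_mono)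
  moreover have "hits N \<epsilon> zs (grid N 0 (Suc (cell N 0 t))) \<omega>"
    using Cons t by (intro Cons.IH[of z']) auto
  ultimately show ?case using t Cons.prems by auto
qed simp

lemma reach_imp_hits:
  assumes "\<omega> \<in> space M" "\<omega> \<notin> cell_jump N (\<rho> / 4)" "4 * \<epsilon> \<le> \<rho>"
    and "successively (\<lambda>a b. dist a b \<ge> \<rho>) zs" "reach \<epsilon> zs 0 \<omega>"
  shows "hits N \<epsilon> zs 0 \<omega>"
proof (cases zs)
  case (Cons z zs')
  then obtain t where "0 \<le> t" "t \<le> 1" "W t \<omega> \<in> cball z \<epsilon>" "reach \<epsilon> zs' t \<omega>"
    using assms(5) by auto
  with reach_imp_hits_tail[OF assms(1-3), of z zs' t] assms(4) Cons grid_nonneg show ?thesis by auto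
qed simp

text \<open>For \<open>2 * \<epsilon> < \<rho>\<close> balls that follow each other in the list are
  disjoint, so the path cannot be in both at one time and the weak order of the visits is
  strict.\<close>

lemma reach_iff:
  assumes "2 * \<epsilon> < \<rho>" "successively (\<lambda>a b. dist a b \<ge> \<rho>) zs"
  shows "reach \<epsilon> zs s \<omega> \<longleftrightarrow> (\<exists>t. strict_mono_on {..<length zs} t \<and>
    (\<forall>k<length zs. t k \<in> {s..1} \<and> W (t k) \<omega> \<in> cball (zs ! k) \<epsilon>))"
  using assms(2)
proof (induction zs arbitrary: s)
  case Nil
  then show ?case by (auto simp: strict_mono_on_def)
next
  case (Cons z zs)
  have zs: "successively (\<lambda>a b. dist a b \<ge> \<rho>) zs"
    using Cons.prems by (cases zs) auto
  note IH = Cons.IH[OF zs]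
  show ?case
  proof
    assume "reach \<epsilon> (z # zs) s \<omega>"
    then obtain t0 where t0: "s \<le> t0" "t0 \<le> 1" "W t0 \<omega> \<in> cball z \<epsilon>" and "reach \<epsilon> zs t0 \<omega>" by auto
    then obtain t where t: "strict_mono_on {..<length zs} t"
      "\<forall>k<length zs. t k \<in> {t0..1} \<and> W (t k) \<omega> \<in> cball (zs ! k) \<epsilon>" using IH by auto
    have less: "t0 < t k" if "k < length zs" for k
    proof -
      from that have "0 < length zs" by linarith
      then have "t 0 \<in> {t0..1}" "W (t 0) \<omega> \<in> cball (zs ! 0) \<epsilon>" using t by auto
      moreover have "dist z (zs ! 0) \<ge> \<rho>" using Cons.prems \<open>0 < length zs\<close> by (cases zs) auto
      ultimately have "t0 \<noteq> t 0"
        using t0(3) assms(1) dist_triangle2[of z "zs ! 0" "W t0 \<omega>"] by auto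
      then have "t0 < t 0" using \<open>t 0 \<in> {t0..1}\<close> by auto
      moreover have "t 0 \<le> t k"
        using strict_mono_onD[OF t(1), of 0 k] that \<open>0 < length zs\<close> by (cases "k = 0") auto
      ultimately show ?thesis by simp
    qed
    define t' where "t' = case_nat t0 t"
    have "strict_mono_on {..<length (z # zs)} t'"
    proof (rule strict_mono_onI)
      fix a b assume "a \<in> {..<length (z # zs)}" "b \<in> {..<length (z # zs)}" "a < b"
      then show "t' a < t' b"
        using less strict_mono_onD[OF t(1)] unfolding t'_def by (cases a; cases b) auto
    qed
    moreover have "\<forall>k<length (z # zs). t' k \<in> {s..1} \<and> W (t' k) \<omega> \<in> cball ((z # zs) ! k) \<epsilon>"
    proof (intro allI impI)
      fix k assume "k < length (z # zs)"
      then show "t' k \<in> {s..1} \<and> W (t' k) \<omega> \<in> cball ((z # zs) ! k) \<epsilon>"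
        using t0 t(2) unfolding t'_def by (cases k) auto
    qed
    ultimately show "\<exists>t. strict_mono_on {..<length (z # zs)} t \<and>
      (\<forall>k<length (z # zs). t k \<in> {s..1} \<and> W (t k) \<omega> \<in> cball ((z # zs) ! k) \<epsilon>)" by blast
  next
    assume "\<exists>t. strict_mono_on {..<length (z # zs)} t \<and>
      (\<forall>k<length (z # zs). t k \<in> {s..1} \<and> W (t k) \<omega> \<in> cball ((z # zs) ! k) \<epsilon>)"
    then obtain t where t: "strict_mono_on {..<length (z # zs)} t"
      "\<And>k. k < length (z # zs) \<Longrightarrow> t k \<in> {s..1} \<and> W (t k) \<omega> \<in> cball ((z # zs) ! k) \<epsilon>" by blast
    have "reach \<epsilon> zs (t 0) \<omega>"
      unfolding IH
    proof (intro exI[of _ "t \<circ> Suc"] conjI allI impI)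
      show "strict_mono_on {..<length zs} (t \<circ> Suc)"
        using strict_mono_onD[OF t(1)] by (intro strict_mono_onI) auto
    next
      fix k assume k: "k < length zs"
      then have "t 0 < t (Suc k)" using strict_mono_onD[OF t(1), of 0 "Suc k"] by auto
      then show "(t \<circ> Suc) k \<in> {t 0..1}" using t(2)[of "Suc k"] k by auto
      show "W ((t \<circ> Suc) k) \<omega> \<in> cball (zs ! k) \<epsilon>" using t(2)[of "Suc k"] k by auto
    qed
    then show "reach \<epsilon> (z # zs) s \<omega>" using t(2)[of 0] by auto
  qed
qed

text \<open>The times at which \<open>z\<close> is visited and from which the remaining visits
  succeed form a compact set \<open>C\<close>; the admissible starting times are those up to its
  maximum.\<close>

lemma closed_reach:
  assumes "\<omega> \<in> space M"
  shows "closed {s\<in>{0..1}. reach \<epsilon> zs s \<omega>}"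
proof (induction zs)
  case Nil
  then show ?case using closed_atLeastAtMost[of 0 "1::real"] by (simp add: atLeastAtMost_def atLeast_def atMost_def Int_def)
next
  case (Cons z zs)
  define C where "C = {t\<in>{0..1}. reach \<epsilon> zs t \<omega>} \<inter> ({0..1} \<inter> (\<lambda>t. W t \<omega>) -` cball z \<epsilon>)"
  have "closed C"
    unfolding C_def
    by (intro closed_Int[OF Cons.IH] continuous_closed_preimage continuous_paths assms) auto
  then have "compact C"
    by (rule compact_eq_bounded_closed[THEN iffD2, OF conjI, rotated])
      (rule bounded_subset[OF bounded_closed_interval[of 0 1]], auto simp: C_def)
  have eq: "{s\<in>{0..1}. reach \<epsilon> (z # zs) s \<omega>} = {s\<in>{0..1}. \<exists>t\<in>C. s \<le> t}"
    unfolding C_def by (auto 0 4)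
  show ?case
  proof (cases "C = {}")
    case True
    then show ?thesis unfolding eq by simp
  next
    case False
    then obtain b where b: "b \<in> C" "\<And>t. t \<in> C \<Longrightarrow> t \<le> b"
      using compact_attains_sup[OF \<open>compact C\<close>] by blast
    have "b \<le> 1" using b by (auto simp: C_def)
    with b have "{s\<in>{0..1}. \<exists>t\<in>C. s \<le> t} = {0..b}" by (force intro: order_trans)
    then show ?thesis unfolding eq by simp
  qed
qed

text \<open>The visiting time is replaced by a rational one, with slack \<open>h m\<close> in the
  radius and in the time from which the rest is reached. For one \<open>m\<close> this gives a
  countable union; as \<open>m\<close> grows, a convergent subsequence of the rational times,
  continuity of the path and \<open>closed_reach\<close> recover an exact visit. Taking
  \<open>max s q\<close> admits the time \<open>s\<close> itself even if it is irrational.\<close>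

lemma sets_reach:
  assumes "s \<in> {0..1}"
  shows "{\<omega>\<in>space M. reach \<epsilon> zs s \<omega>} \<in> sets M"
  using assms
proof (induction zs arbitrary: s)
  case Nil
  then show ?case by simp
next
  case (Cons z zs)
  define h :: "nat \<Rightarrow> real" where "h m = 1 / real (Suc m)" for m
  define S where "S m q = {\<omega>\<in>space M. W (max s q) \<omega> \<in> cball z (\<epsilon> + h m)}
    \<inter> {\<omega>\<in>space M. reach \<epsilon> zs (max 0 (max s q - h m)) \<omega>}" for m q
  define D where "D = \<rat> \<inter> {0..1::real}"
  have h: "h m > 0" for m by (simp add: h_def)
  have h0: "h \<longlonglongrightarrow> 0"
    unfolding h_def using LIMSEQ_inverse_real_of_nat by (simp add: inverse_eq_divide)
  have S: "S m q \<in> sets M" if "q \<in> D" for m q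
  proof -
    have q: "max s q \<in> {0..1}" using that Cons.prems by (auto simp: D_def)
    have "{\<omega>\<in>space M. W (max s q) \<omega> \<in> cball z (\<epsilon> + h m)} \<in> sets M"
      using measurable_sets[OF measurable_W[OF q], of "cball z (\<epsilon> + h m)"]
      by (simp add: vimage_def Int_def conj_commute)
    moreover have "max 0 (max s q - h m) \<in> {0..1}" using q h[of m] by auto
    ultimately show ?thesis unfolding S_def using Cons.IH by blast
  qed
  have "{\<omega>\<in>space M. reach \<epsilon> (z # zs) s \<omega>} = (\<Inter>m. \<Union>q\<in>D. S m q)"
  proof (intro subset_antisym subsetI)
    fix \<omega> assume "\<omega> \<in> {\<omega>\<in>space M. reach \<epsilon> (z # zs) s \<omega>}"
    then obtain t where \<omega>: "\<omega> \<in> space M" and t: "s \<le> t" "t \<le> 1" "W t \<omega> \<in> cball z \<epsilon>"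
      and rest: "reach \<epsilon> zs t \<omega>" by auto
    show "\<omega> \<in> (\<Inter>m. \<Union>q\<in>D. S m q)"
    proof (intro INT_I)
      fix m
      have t01: "t \<in> {0..1}" using t Cons.prems by auto
      then obtain d where d: "d > 0" "\<And>u. u \<in> {0..1} \<Longrightarrow> dist u t < d \<Longrightarrow> dist (W u \<omega>) (W t \<omega>) < h m"
        using continuous_paths[OF \<omega>] h[of m] unfolding continuous_on_iff by blast
      obtain q where q: "q \<in> D" "q \<le> t" "t - q < min d (h m)"
      proof (cases "t = 0")
        case True
        then show ?thesis using d(1) h[of m] by (intro that[of 0]) (auto simp: D_def)
      next
        case False
        then have "max 0 (t - min d (h m)) < t" using t01 d(1) h[of m] by auto
        then obtain q where "q \<in> \<rat>" "max 0 (t - min d (h m)) < q" "q < t"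
          using Rats_dense_in_real by blast
        then show ?thesis using t01 by (intro that[of q]) (auto simp: D_def)
      qed
      have le: "max s q \<le> t" "t - max s q < d" "t - max s q < h m" using q t by auto
      have "max s q \<in> {0..1}" using Cons.prems le t by auto
      moreover have "dist (max s q) t < d" using le by (simp add: dist_real_def)
      ultimately have "dist (W (max s q) \<omega>) (W t \<omega>) < h m" by (rule d(2))
      then have "W (max s q) \<omega> \<in> cball z (\<epsilon> + h m)"
        using t(3) dist_triangle[of z "W (max s q) \<omega>" "W t \<omega>"] by (simp add: dist_commute)
      moreover have "reach \<epsilon> zs (max 0 (max s q - h m)) \<omega>"
        using rest by (rule reach_antimono) (use le t01 in auto)
      ultimately have "\<omega> \<in> S m q" using \<omega> by (simp add: S_def)
      with q(1) show "\<omega> \<in> (\<Union>q\<in>D. S m q)" by blast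
    qed
  next
    fix \<omega> assume *: "\<omega> \<in> (\<Inter>m. \<Union>q\<in>D. S m q)"
    then have \<omega>: "\<omega> \<in> space M" by (auto simp: S_def)
    from * have "\<forall>m. \<exists>q. q \<in> D \<and> \<omega> \<in> S m q" by blast
    from choice[OF this] obtain q where q: "\<And>m. q m \<in> D" "\<And>m. \<omega> \<in> S m (q m)" by blast
    define a where "a m = max s (q m)" for m
    have a: "a m \<in> {s..1}" for m using q(1)[of m] Cons.prems by (auto simp: a_def D_def)
    have aW: "dist z (W (a m) \<omega>) \<le> \<epsilon> + h m" and ar: "reach \<epsilon> zs (max 0 (a m - h m)) \<omega>" for m
      using q(2)[of m] by (auto simp: S_def a_def)
    have "compact {s..1}" by simp
    then obtain t r where t: "t \<in> {s..1}" and r: "strict_mono r" and lim: "(a \<circ> r) \<longlonglongrightarrow> t"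
      using a unfolding compact_def by blast
    have hr: "(\<lambda>m. h (r m)) \<longlonglongrightarrow> 0"
      using LIMSEQ_subseq_LIMSEQ[OF h0 r] by (simp add: o_def)
    have t01: "t \<in> {0..1}" "\<And>m. a m \<in> {0..1}" using t a Cons.prems by (simp_all, meson order_trans)
    have limW: "(\<lambda>m. W (a (r m)) \<omega>) \<longlonglongrightarrow> W t \<omega>"
      using continuous_paths[OF \<omega>] t01 lim unfolding continuous_on_sequentially by (auto simp: o_def)
    have "(\<lambda>m. dist z (W (a (r m)) \<omega>)) \<longlonglongrightarrow> dist z (W t \<omega>)"
      by (intro tendsto_intros limW)
    moreover have "(\<lambda>m. \<epsilon> + h (r m)) \<longlonglongrightarrow> \<epsilon> + 0"
      by (intro tendsto_intros hr)
    ultimately have near: "dist z (W t \<omega>) \<le> \<epsilon>"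
      using LIMSEQ_le[of "\<lambda>m. dist z (W (a (r m)) \<omega>)" _ "\<lambda>m. \<epsilon> + h (r m)" "\<epsilon> + 0"] aW by auto
    have lim': "(\<lambda>m. max 0 (a (r m) - h (r m))) \<longlonglongrightarrow> max 0 (t - 0)"
      using lim by (intro tendsto_intros hr) (simp add: o_def)
    have "max 0 (a (r m) - h (r m)) \<in> {s\<in>{0..1}. reach \<epsilon> zs s \<omega>}" for m
      using ar[of "r m"] t01(2)[of "r m"] h[of "r m"] by auto
    then have "max 0 (t - 0) \<in> {s\<in>{0..1}. reach \<epsilon> zs s \<omega>}"
      using closed_sequentially[OF closed_reach[OF \<omega>, of \<epsilon> zs] _ lim'] by blast
    then have "reach \<epsilon> zs t \<omega>" using t01 by (simp add: max_absorb2)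
    with near t \<omega> show "\<omega> \<in> {\<omega>\<in>space M. reach \<epsilon> (z # zs) s \<omega>}" by auto
  qed
  moreover have "countable D" unfolding D_def by (intro countable_Int1 countable_rat)
  ultimately show ?case
    using S by (auto intro!: sets.countable_INT sets.countable_UN')
qed

end

section \<open>The upper bound\<close>

context brownian_motion
begin

lemma start_null: "{\<omega>\<in>space M. W 0 \<omega> \<noteq> x} \<in> sets M \<and> prob {\<omega>\<in>space M. W 0 \<omega> \<noteq> x} = 0"
proof -
  have "{\<omega>\<in>space M. W 0 \<omega> \<noteq> x} = space M - W 0 -` {x} \<inter> space M" by auto
  moreover have "W 0 -` {x} \<inter> space M \<in> sets M"
    by (rule measurable_sets[OF measurable_W]) auto
  ultimately have "{\<omega>\<in>space M. W 0 \<omega> \<noteq> x} \<in> sets M" by simp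
  moreover have "AE \<omega> in M. \<omega> \<notin> {\<omega>\<in>space M. W 0 \<omega> \<noteq> x}" using start by auto
  ultimately show ?thesis using prob_eq_0 by blast
qed

text \<open>Apart from a null set, a path either oscillates by \<open>\<rho> / 4\<close> in some
  cell or makes its visits in distinct cells, where \<open>hits_small\<close> applies with the whole
  space as past and accuracy \<open>\<epsilon>\<close>. The tail bound enters with two exponents:
  \<open>d + 3\<close> runs the induction, and \<open>q\<close> is large enough that the oscillation
  probability, of order \<open>\<epsilon> ^ (2 * q - 2)\<close>, is dominated by the claimed
  power.\<close>

lemma prob_reach_le:
  assumes N: "1 \<le> real N * \<epsilon>\<^sup>2" "real N * \<epsilon>\<^sup>2 \<le> 2" and \<epsilon>: "0 < \<epsilon>" "\<epsilon> \<le> 1"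
    and K1: "\<And>s t w r. 0 \<le> s \<Longrightarrow> s \<le> t \<Longrightarrow> t \<le> 1 \<Longrightarrow> norm w \<ge> \<rho> \<Longrightarrow> r \<ge> 0 \<Longrightarrow>
      prob {\<omega> \<in> space M. W t \<omega> - W s \<omega> \<in> cball w r} \<le> K1 * r ^ DIM('a)" "K1 \<ge> 0"
    and K2: "\<And>s t r \<eta>. 0 \<le> s \<Longrightarrow> s \<le> t \<Longrightarrow> t \<le> 1 \<Longrightarrow> r > 0 \<Longrightarrow> (t - s) / r\<^sup>2 \<le> \<eta> \<Longrightarrow>
      prob {\<omega> \<in> space M. W t \<omega> - W s \<omega> \<in> {y. norm y \<ge> r}} \<le> K2 * \<eta> ^ (DIM('a) + 3)" "K2 \<ge> 0"
    and T: "\<And>s t r \<eta>. 0 \<le> s \<Longrightarrow> s \<le> t \<Longrightarrow> t \<le> 1 \<Longrightarrow> r > 0 \<Longrightarrow> (t - s) / r\<^sup>2 \<le> \<eta> \<Longrightarrow>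
      prob {\<omega> \<in> space M. W t \<omega> - W s \<omega> \<in> {y. norm y \<ge> r}} \<le> T * \<eta> ^ q" "T \<ge> 0"
    and q: "q \<ge> 3" "(DIM('a) - 2) * length zs + 2 \<le> 2 * q"
    and d: "DIM('a) \<ge> 2" and \<rho>: "4 * \<epsilon> \<le> \<rho>"
    and zs: "successively (\<lambda>a b. dist a b \<ge> \<rho>) (x # zs)"
  shows "prob {\<omega>\<in>space M. reach \<epsilon> zs 0 \<omega>}
    \<le> (128 * T * (256 / \<rho>\<^sup>2) ^ q + (3 * 20 ^ DIM('a) * K1 + 256 * 36 ^ DIM('a) * K1 * K2) ^ length zs)
      * (\<epsilon> ^ (DIM('a) - 2)) ^ length zs"
proof -
  let ?K0 = "3 * 20 ^ DIM('a) * K1 + 256 * 36 ^ DIM('a) * K1 * K2"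
  have "\<rho> > 0" using \<rho> \<epsilon> by linarith
  have zs': "successively (\<lambda>a b. dist a b \<ge> \<rho>) zs" using zs by (cases zs) auto
  have 1: "small (cell_jump N (\<rho> / 4)) (128 * T * (16 * \<epsilon>\<^sup>2 / (\<rho> / 4)\<^sup>2) ^ q / \<epsilon>\<^sup>2)"
    by (rule cell_jump_small[OF N \<epsilon> T q(1)]) (use \<open>\<rho> > 0\<close> in auto)
  have 2: "small {\<omega>\<in>space M. norm (W 0 \<omega> - x) \<le> \<epsilon> \<and> hits N \<epsilon> zs 0 \<omega>}
    (prob (space M) * ?K0 ^ length zs * (\<epsilon> / \<epsilon>) ^ DIM('a) * (\<epsilon> ^ (DIM('a) - 2)) ^ length zs)"
    by (rule hits_small[OF N \<epsilon> K1 K2 d cyl.whole zs]) auto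
  have 3: "small {\<omega>\<in>space M. W 0 \<omega> \<noteq> x} 0"
    unfolding small_def using start_null by (intro bexI[of _ "{\<omega>\<in>space M. W 0 \<omega> \<noteq> x}"]) auto
  have "128 * T * (16 * \<epsilon>\<^sup>2 / (\<rho> / 4)\<^sup>2) ^ q / \<epsilon>\<^sup>2 \<le> 128 * T * (256 / \<rho>\<^sup>2) ^ q * (\<epsilon> ^ (DIM('a) - 2)) ^ length zs"
  proof -
    have "(\<epsilon>\<^sup>2) ^ q / \<epsilon>\<^sup>2 = \<epsilon> ^ (2 * q - 2)"
      using q \<epsilon> by (simp add: power_diff flip: power_mult)
    also have "\<dots> \<le> \<epsilon> ^ ((DIM('a) - 2) * length zs)"
      using q \<epsilon> by (intro power_decreasing) auto
    also have "\<dots> = (\<epsilon> ^ (DIM('a) - 2)) ^ length zs" by (rule power_mult)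
    finally have le: "(\<epsilon>\<^sup>2) ^ q / \<epsilon>\<^sup>2 \<le> (\<epsilon> ^ (DIM('a) - 2)) ^ length zs" .
    have "16 * \<epsilon>\<^sup>2 / (\<rho> / 4)\<^sup>2 = 256 / \<rho>\<^sup>2 * \<epsilon>\<^sup>2" by (simp add: power_divide)
    then have "128 * T * (16 * \<epsilon>\<^sup>2 / (\<rho> / 4)\<^sup>2) ^ q / \<epsilon>\<^sup>2 = 128 * T * (256 / \<rho>\<^sup>2) ^ q * ((\<epsilon>\<^sup>2) ^ q / \<epsilon>\<^sup>2)"
      by (simp only: power_mult_distrib) simp
    also have "\<dots> \<le> 128 * T * (256 / \<rho>\<^sup>2) ^ q * (\<epsilon> ^ (DIM('a) - 2)) ^ length zs"
      using T(2) by (intro mult_left_mono[OF le]) auto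
    finally show ?thesis .
  qed
  then have "small {\<omega>\<in>space M. reach \<epsilon> zs 0 \<omega>}
    ((128 * T * (256 / \<rho>\<^sup>2) ^ q + ?K0 ^ length zs) * (\<epsilon> ^ (DIM('a) - 2)) ^ length zs)"
  proof (intro small_mono[OF small_Un[OF small_Un[OF 1 2] 3]])
    show "{\<omega>\<in>space M. reach \<epsilon> zs 0 \<omega>} \<subseteq> cell_jump N (\<rho> / 4)
      \<union> {\<omega>\<in>space M. norm (W 0 \<omega> - x) \<le> \<epsilon> \<and> hits N \<epsilon> zs 0 \<omega>} \<union> {\<omega>\<in>space M. W 0 \<omega> \<noteq> x}"
      using reach_imp_hits[OF _ _ \<rho> zs'] \<epsilon> by auto
  qed (use \<epsilon> in \<open>auto simp: prob_space algebra_simps\<close>)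
  then obtain E where E: "E \<in> sets M" "{\<omega>\<in>space M. reach \<epsilon> zs 0 \<omega>} \<subseteq> E"
    "prob E \<le> (128 * T * (256 / \<rho>\<^sup>2) ^ q + ?K0 ^ length zs) * (\<epsilon> ^ (DIM('a) - 2)) ^ length zs"
    unfolding small_def by blast
  then show ?thesis using finite_measure_mono[OF E(2,1)] by linarith
qed

end

section \<open>The lower bound\<close>

text \<open>Cauchy-Schwarz in linearised form: with \<open>X\<close> the number of events that occur
  and \<open>U\<close> their union,
  \<open>2 * l * X \<le> X\<^sup>2 + l\<^sup>2 * indicator U\<close> holds pointwise, and
  \<open>l = Q / S\<close> is the best choice after taking expectations.\<close>

lemma (in prob_space) second_moment_bound:
  assumes "finite I" and A: "\<And>i. i \<in> I \<Longrightarrow> A i \<in> sets M"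
    and S: "S \<le> (\<Sum>i\<in>I. prob (A i))" "S > 0"
    and Q: "(\<Sum>i\<in>I. \<Sum>j\<in>I. prob (A i \<inter> A j)) \<le> Q" "Q > 0"
  shows "S\<^sup>2 / Q \<le> prob (\<Union>i\<in>I. A i)"
proof -
  define U where "U = (\<Union>i\<in>I. A i)"
  define l where "l = Q / S"
  have l: "l > 0" using S Q by (simp add: l_def)
  have U: "U \<in> sets M" unfolding U_def using assms by auto
  define X :: "'a \<Rightarrow> real" where "X \<omega> = (\<Sum>i\<in>I. indicator (A i) \<omega>)" for \<omega>
  have XX: "(X \<omega>)\<^sup>2 = (\<Sum>i\<in>I. \<Sum>j\<in>I. indicator (A i \<inter> A j) \<omega>)" for \<omega>
    by (simp add: X_def power2_eq_square sum_product indicator_inter_arith)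
  have int: "integrable M (\<lambda>\<omega>. indicator B \<omega> :: real)" if "B \<in> sets M" for B
    using that by (simp add: emeasure_eq_measure)
  have le: "2 * l * X \<omega> \<le> (X \<omega>)\<^sup>2 + l\<^sup>2 * indicator U \<omega>" for \<omega>
  proof (cases "\<omega> \<in> U")
    case True
    have "0 \<le> (X \<omega> - l)\<^sup>2" by simp
    then show ?thesis using True by (simp add: power2_diff mult.commute mult.left_commute)
  next
    case False
    then have "X \<omega> = 0" unfolding X_def U_def by (intro sum.neutral) auto
    then show ?thesis by simp
  qed
  have EX: "expectation X = (\<Sum>i\<in>I. prob (A i))"
    unfolding X_def using A int by (subst Bochner_Integration.integral_sum) auto
  have EXX: "expectation (\<lambda>\<omega>. (X \<omega>)\<^sup>2) = (\<Sum>i\<in>I. \<Sum>j\<in>I. prob (A i \<inter> A j))"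
  proof -
    have "expectation (\<lambda>\<omega>. (X \<omega>)\<^sup>2) = (\<Sum>i\<in>I. expectation (\<lambda>\<omega>. \<Sum>j\<in>I. indicator (A i \<inter> A j) \<omega>))"
      unfolding XX using A int by (intro Bochner_Integration.integral_sum Bochner_Integration.integrable_sum) auto
    also have "\<dots> = (\<Sum>i\<in>I. \<Sum>j\<in>I. expectation (indicator (A i \<inter> A j)))"
      using A int by (intro sum.cong refl Bochner_Integration.integral_sum) auto
    also have "\<dots> = (\<Sum>i\<in>I. \<Sum>j\<in>I. prob (A i \<inter> A j))"
      using A by (intro sum.cong refl) auto
    finally show ?thesis .
  qed
  have iX: "integrable M X" unfolding X_def using A int by auto
  have iXX: "integrable M (\<lambda>\<omega>. (X \<omega>)\<^sup>2)"
    unfolding XX using A int by (intro Bochner_Integration.integrable_sum) auto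
  have "2 * l * expectation X = expectation (\<lambda>\<omega>. 2 * l * X \<omega>)" by simp
  also have "\<dots> \<le> expectation (\<lambda>\<omega>. (X \<omega>)\<^sup>2 + l\<^sup>2 * indicator U \<omega>)"
    using le iX iXX int[OF U] by (intro integral_mono) auto
  also have "\<dots> = expectation (\<lambda>\<omega>. (X \<omega>)\<^sup>2) + l\<^sup>2 * prob U"
    using iXX int[OF U] U by simp
  finally have "2 * l * S \<le> Q + l\<^sup>2 * prob U"
    using S Q l unfolding EX EXX by (smt (verit) mult_left_mono)
  then have "Q \<le> (Q / S)\<^sup>2 * prob U" using S unfolding l_def by simp
  then have "S\<^sup>2 / Q \<le> prob U" using S Q by (simp add: power_divide power2_eq_square field_simps)
  then show ?thesis unfolding U_def .
qed

section \<open>A summable bound for return probabilities, and separated time windows\<close>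

text \<open>Bounds the probability of being in the same ball again after \<open>j\<close> time
  steps. The decay is \<open>j\<close> to the power -3/2 in every dimension: where the base is at
  most 1 the exponent \<open>d \<ge> 3\<close> may be lowered to 3. The value at 0 is the trivial
  bound.\<close>

definition ret :: "real \<Rightarrow> nat \<Rightarrow> real" where
  "ret c j = (if j = 0 then 1 else c / sqrt (real j) ^ 3)"

lemma ret_nonneg: "c \<ge> 0 \<Longrightarrow> ret c j \<ge> 0"
  by (simp add: ret_def)

lemma ret_pos: "j > 0 \<Longrightarrow> ret c j = c / sqrt (real j) ^ 3"
  by (simp add: ret_def)

lemma summable_ret: "summable (ret c)"
proof -
  have "summable (\<lambda>j. c * real j powr (- 3 / 2))"
    by (intro summable_mult) (simp add: summable_real_powr_iff)
  moreover have "\<forall>\<^sub>F j in sequentially. c * real j powr (- 3 / 2) = ret c j"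
  proof (rule eventually_mono[OF eventually_gt_at_top[of 0]])
    fix j :: nat assume j: "j > 0"
    have "sqrt (real j) ^ 3 = (real j powr (1 / 2)) powr 3"
      using j by (simp add: powr_half_sqrt powr_numeral)
    also have "\<dots> = real j powr (3 / 2)" by (simp add: powr_powr)
    finally have e: "sqrt (real j) ^ 3 = real j powr (3 / 2)" .
    have "real j powr (- 3 / 2) = inverse (real j powr (3 / 2))"
      using powr_minus[of "real j" "3 / 2"] by simp
    then show "c * real j powr (- 3 / 2) = ret c j"
      using j unfolding ret_def e divide_inverse by simp
  qed
  ultimately show ?thesis by (rule summable_cong[THEN iffD1, rotated])
qed

lemma suminf_ret_ge_1: "c \<ge> 0 \<Longrightarrow> suminf (ret c) \<ge> 1"
  using sum_le_suminf[OF summable_ret, of "{0}" c] ret_nonneg by (auto simp: ret_def)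

text \<open>With truncated subtraction \<open>(i' - i) + (i - i')\<close> is the distance of
  \<open>i\<close> and \<open>i'\<close>. Either side of \<open>i\<close> contributes at most the
  full series.\<close>

lemma sum_ret_le:
  assumes "c \<ge> 0" "i < N"
  shows "(\<Sum>i'<N. ret c ((i' - i) + (i - i'))) \<le> 2 * suminf (ret c)"
proof -
  have le: "sum (ret c) {..<m} \<le> suminf (ret c)" for m
    using sum_le_suminf[OF summable_ret, of "{..<m}" c] ret_nonneg[OF assms(1)] by auto
  have "{..<N} = {..<i} \<union> {i..<N}" using assms(2) by auto
  then have "(\<Sum>i'<N. ret c ((i' - i) + (i - i')))
      = (\<Sum>i'\<in>{..<i}. ret c ((i' - i) + (i - i'))) + (\<Sum>i'\<in>{i..<N}. ret c ((i' - i) + (i - i')))"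
    by (simp add: sum.union_disjoint ivl_disj_int)
  also have "(\<Sum>i'\<in>{..<i}. ret c ((i' - i) + (i - i'))) = sum (ret c) {0<..<Suc i}"
    by (rule sum.reindex_bij_witness[of _ "\<lambda>j. i - j" "\<lambda>j. i - j"]) auto
  also have "sum (ret c) {0<..<Suc i} \<le> sum (ret c) {..<Suc i}"
    using ret_nonneg[OF assms(1)] by (intro sum_mono2) auto
  also have "(\<Sum>i'\<in>{i..<N}. ret c ((i' - i) + (i - i'))) = sum (ret c) {..<N - i}"
    by (rule sum.reindex_bij_witness[of _ "\<lambda>j. i + j" "\<lambda>j. j - i"]) auto
  finally show ?thesis using le[of "Suc i"] le[of "N - i"] by linarith
qed

text \<open>The time window of the \<open>k\<close>-th visit is \<open>[(2k - 1)/(2n), 2k/(2n)]\<close>, so that consecutive windows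
  are separated by \<open>1/(2n)\<close>.\<close>

definition wtime :: "nat \<Rightarrow> nat \<Rightarrow> nat \<Rightarrow> nat \<Rightarrow> real" where
  "wtime n N k i = (if k = 0 then 0 else (2 * real k - 1) / (2 * real n) + real i / (2 * real n * real N))"

lemma wtime_0 [simp]: "wtime n N 0 i = 0"
  by (simp add: wtime_def)

lemma wtime_nonneg: "0 \<le> wtime n N k i"
  by (cases k) (auto simp: wtime_def)

lemma wtime_le:
  assumes "n > 0" "i < N"
  shows "wtime n N k i \<le> 2 * real k / (2 * real n)"
proof (cases "k = 0")
  case False
  have "real i / (2 * real n * real N) \<le> 1 / (2 * real n)"
    using assms by (simp add: divide_le_eq)
  then have "wtime n N k i \<le> (2 * real k - 1) / (2 * real n) + 1 / (2 * real n)"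
    using False by (simp add: wtime_def)
  also have "\<dots> = 2 * real k / (2 * real n)" by (simp add: diff_divide_distrib)
  finally show ?thesis .
qed simp

lemma wtime_le_1: "n > 0 \<Longrightarrow> i < N \<Longrightarrow> k \<le> n \<Longrightarrow> wtime n N k i \<le> 1"
  by (rule order_trans[OF wtime_le]) (auto simp: divide_le_eq)

lemma wtime_gap:
  assumes "n > 0" "i < N"
  shows "1 / (2 * real n) \<le> wtime n N (Suc k) i' - wtime n N k i"
proof -
  have "(2 * real (Suc k) - 1) / (2 * real n) \<le> wtime n N (Suc k) i'"
    by (simp add: wtime_def)
  moreover have "(2 * real (Suc k) - 1) / (2 * real n) = 2 * real k / (2 * real n) + 1 / (2 * real n)"
    by (simp add: add_divide_distrib)
  ultimately show ?thesis using wtime_le[OF assms, of k] by linarith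
qed

lemma wtime_strict_mono:
  assumes "n > 0" "\<And>k. k \<le> m \<Longrightarrow> \<sigma> k < N" "j < k" "k \<le> m"
  shows "wtime n N j (\<sigma> j) < wtime n N k (\<sigma> k)"
  using assms(3,4)
proof (induction k)
  case (Suc k)
  have "wtime n N k (\<sigma> k) < wtime n N (Suc k) (\<sigma> (Suc k))"
  proof -
    have "0 < 1 / (2 * real n)" using assms(1) by simp
    moreover have "1 / (2 * real n) \<le> wtime n N (Suc k) (\<sigma> (Suc k)) - wtime n N k (\<sigma> k)"
      using Suc.prems by (intro wtime_gap assms) auto
    ultimately show ?thesis by linarith
  qed
  with Suc show ?case by (cases "j = k") auto
qed simp

section \<open>First and second moment of the number of visiting tuples\<close>

context brownian_motion
begin

text \<open>The summand 1 in the constant covers \<open>r \<ge> sqrt (t - s)\<close>, where the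
  right side is at least 1. Otherwise the ratio is below 1 and its power \<open>d\<close> is at most
  its cube.\<close>

lemma prob_return_le:
  assumes "0 \<le> s" "s < t" "t \<le> 1" "r > 0" "DIM('a) \<ge> 3"
  shows "prob {\<omega> \<in> space M. W t \<omega> - W s \<omega> \<in> cball 0 r}
    \<le> (unit_ball_vol DIM('a) + 1) * (r / sqrt (t - s)) ^ 3"
proof (cases "r / sqrt (t - s) \<ge> 1")
  case True
  have u: "1 \<le> unit_ball_vol (real DIM('a)) + 1" by simp
  have "1 * 1 \<le> (unit_ball_vol DIM('a) + 1) * (r / sqrt (t - s)) ^ 3"
    by (rule mult_mono[OF u one_le_power[OF True]]) simp_all
  then show ?thesis unfolding mult_1 by (rule order_trans[OF prob_le_1])
next
  case False
  let ?a = "r / sqrt (t - s)"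
  have a: "0 \<le> ?a" "?a \<le> 1" using False assms by auto
  have "prob {\<omega> \<in> space M. W t \<omega> - W s \<omega> \<in> cball 0 r}
    \<le> unit_ball_vol DIM('a) / sqrt (t - s) ^ DIM('a) * r ^ DIM('a)"
    using assms by (intro prob_increment_gap_le) auto
  also have "\<dots> = unit_ball_vol DIM('a) * ?a ^ DIM('a)" by (simp add: power_divide)
  also have "\<dots> \<le> unit_ball_vol DIM('a) * ?a ^ 3"
    using a assms by (intro mult_left_mono power_decreasing) auto
  also have "\<dots> \<le> (unit_ball_vol DIM('a) + 1) * ?a ^ 3"
    using a by (intro mult_right_mono) auto
  finally show ?thesis .
qed

definition visits :: "nat \<Rightarrow> nat \<Rightarrow> real \<Rightarrow> (nat \<Rightarrow> 'a) \<Rightarrow> (nat \<Rightarrow> nat) \<Rightarrow> nat \<Rightarrow> 'w set" where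
  "visits n N \<epsilon> z \<sigma> m = {\<omega>\<in>space M. \<forall>k\<in>{1..m}. W (wtime n N k (\<sigma> k)) \<omega> \<in> cball (z k) \<epsilon>}"

lemma sets_visits:
  assumes "n > 0" "\<And>k. \<sigma> k < N" "m \<le> n"
  shows "visits n N \<epsilon> z \<sigma> m \<in> sets M"
proof -
  have "{\<omega>\<in>space M. W (wtime n N k (\<sigma> k)) \<omega> \<in> cball (z k) \<epsilon>} \<in> sets M" if "k \<in> {1..m}" for k
  proof -
    have "wtime n N k (\<sigma> k) \<in> {0..1}"
      using wtime_nonneg wtime_le_1 assms that by auto
    from measurable_sets[OF measurable_W[OF this], of "cball (z k) \<epsilon>"] show ?thesis
      by (simp add: vimage_def Int_def conj_commute)
  qed
  then show ?thesis unfolding visits_def by (intro sets.sets_Collect_finite_All) auto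
qed

text \<open>Each increment is required to be within \<open>\<epsilon> / n\<close> of the step
  between consecutive points, so the error after \<open>k \<le> n\<close> steps is at most
  \<open>k * \<epsilon> / n \<le> \<epsilon>\<close>. The increments are independent, and elapsed
  times of at least \<open>1 / (2 * n)\<close> turn the exponent
  \<open>R\<^sup>2 / (2 * \<delta>)\<close> into \<open>R\<^sup>2 * n\<close>.\<close>

lemma prob_visits_ge:
  assumes n: "n > 0" and \<sigma>: "\<And>k. \<sigma> k < N" and z0: "z 0 = x"
    and R: "\<And>k. k < n \<Longrightarrow> norm (z (Suc k) - z k) + 1 \<le> R" and \<epsilon>: "0 < \<epsilon>" "\<epsilon> \<le> 1"
  shows "prob (visits n N \<epsilon> z \<sigma> n) \<ge>
    (exp (- R\<^sup>2 * real n) / sqrt (2 * pi) ^ DIM('a) * unit_ball_vol DIM('a) * (\<epsilon> / real n) ^ DIM('a)) ^ n"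
    (is "_ \<ge> ?p ^ n")
proof -
  let ?t = "\<lambda>k. wtime n N k (\<sigma> k)"
  let ?r = "\<epsilon> / real n"
  have p: "?p \<ge> 0" using \<epsilon> by simp
  have r: "0 \<le> ?r" "?r \<le> 1" using \<epsilon> n by (auto simp: divide_le_eq)
  have "\<exists>C. cyl (?t m) C \<and> ?p ^ m \<le> prob C \<and>
    (\<forall>\<omega>\<in>C. W 0 \<omega> = x \<longrightarrow> (\<forall>k\<le>m. norm (W (?t k) \<omega> - z k) \<le> real k * ?r))" if "m \<le> n" for m
    using that
  proof (induction m)
    case 0
    show ?case
      by (intro exI[of _ "space M"]) (use cyl.whole z0 in \<open>auto simp: prob_space\<close>)
  next
    case (Suc m)
    then obtain C where C: "cyl (?t m) C" "?p ^ m \<le> prob C"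
      and near: "\<And>\<omega> k. \<omega> \<in> C \<Longrightarrow> W 0 \<omega> = x \<Longrightarrow> k \<le> m \<Longrightarrow> norm (W (?t k) \<omega> - z k) \<le> real k * ?r"
      by auto
    let ?w = "z (Suc m) - z m"
    let ?I = "{\<omega>\<in>space M. W (?t (Suc m)) \<omega> - W (?t m) \<omega> \<in> cball ?w ?r}"
    have gap: "1 / (2 * real n) \<le> ?t (Suc m) - ?t m" by (rule wtime_gap[OF n \<sigma>])
    moreover have "0 < 1 / (2 * real n)" using n by simp
    ultimately have le: "?t m \<le> ?t (Suc m)" by linarith
    have le1: "?t (Suc m) \<le> 1" using wtime_le_1 n \<sigma> Suc.prems by auto
    have cyl: "cyl (?t (Suc m)) (C \<inter> ?I)" by (rule cyl.step[OF C(1) le le1]) auto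
    have "?p ^ Suc m \<le> prob C * ?p" using C(2) p by (simp only: power_Suc2 mult_right_mono)
    also have "\<dots> \<le> prob C * prob ?I"
    proof (rule mult_left_mono)
      have "exp (- R\<^sup>2 / (2 * (1 / (2 * real n)))) / sqrt (2 * pi) ^ DIM('a) * unit_ball_vol DIM('a) * ?r ^ DIM('a)
        \<le> prob ?I"
      proof (rule prob_increment_ge[OF wtime_nonneg gap le1 _ r(1)])
        have "norm ?w + 1 \<le> R" using R[of m] Suc.prems by simp
        then show "norm ?w + ?r \<le> R" using r(2) by linarith
      qed (use n in simp)
      then show "?p \<le> prob ?I" by simp
    qed simp
    also have "\<dots> = prob (C \<inter> ?I)" by (rule prob_cyl_step[OF C(1) le le1, symmetric]) auto
    finally have prob: "?p ^ Suc m \<le> prob (C \<inter> ?I)" .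
    have "norm (W (?t k) \<omega> - z k) \<le> real k * ?r"
      if \<omega>: "\<omega> \<in> C \<inter> ?I" "W 0 \<omega> = x" and k: "k \<le> Suc m" for \<omega> k
    proof (cases "k \<le> m")
      case True
      then show ?thesis using near \<omega> by auto
    next
      case False
      then have k: "k = Suc m" using k by simp
      have "norm (W (?t (Suc m)) \<omega> - z (Suc m))
          \<le> norm (W (?t m) \<omega> - z m) + norm (W (?t (Suc m)) \<omega> - W (?t m) \<omega> - ?w)"
        using norm_triangle_ineq[of "W (?t m) \<omega> - z m" "W (?t (Suc m)) \<omega> - W (?t m) \<omega> - ?w"]
        by (simp add: algebra_simps)
      moreover have "norm (W (?t m) \<omega> - z m) \<le> real m * ?r" using near[of \<omega> m] \<omega> by auto
      moreover have "norm (W (?t (Suc m)) \<omega> - W (?t m) \<omega> - ?w) \<le> ?r"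
        using \<omega> by (simp add: dist_norm norm_minus_commute)
      moreover have "real k * ?r = real m * ?r + ?r" unfolding k by (simp add: algebra_simps add_divide_distrib)
      ultimately show ?thesis unfolding k by linarith
    qed
    with cyl prob show ?case by blast
  qed
  from this[of n] obtain C where C: "cyl (?t n) C" "?p ^ n \<le> prob C"
    and near: "\<And>\<omega> k. \<omega> \<in> C \<Longrightarrow> W 0 \<omega> = x \<Longrightarrow> k \<le> n \<Longrightarrow> norm (W (?t k) \<omega> - z k) \<le> real k * ?r"
    by auto
  have "prob C \<le> prob (visits n N \<epsilon> z \<sigma> n)"
  proof (rule finite_measure_mono_AE)
    show "AE \<omega> in M. \<omega> \<in> C \<longrightarrow> \<omega> \<in> visits n N \<epsilon> z \<sigma> n"
      using start
    proof (rule AE_mp, intro AE_I2 impI)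
      fix \<omega> assume \<omega>: "\<omega> \<in> space M" "W 0 \<omega> = x" "\<omega> \<in> C"
      have "W (?t k) \<omega> \<in> cball (z k) \<epsilon>" if "k \<in> {1..n}" for k
      proof -
        have "norm (W (?t k) \<omega> - z k) \<le> real k * ?r" using near \<omega> that by auto
        also have "\<dots> \<le> real n * ?r" using that r by (intro mult_right_mono) auto
        also have "\<dots> = \<epsilon>" using n by simp
        finally show ?thesis by (simp add: dist_norm norm_minus_commute)
      qed
      then show "\<omega> \<in> visits n N \<epsilon> z \<sigma> n" using \<omega> by (auto simp: visits_def)
    qed
  qed (use sets_visits[OF n \<sigma>] in auto)
  then show ?thesis using C by linarith
qed

text \<open>In each window only the earlier time \<open>?f k\<close> and the later time
  \<open>?l k\<close> of the two tuples matter. Along \<open>?l m\<close>,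
  \<open>?f (Suc m)\<close>, \<open>?l (Suc m)\<close> the first increment bridges a gap of at least
  \<open>1 / (2 * n)\<close> and has bounded density, giving \<open>K * \<epsilon> ^ d\<close>; the
  second is a return to within \<open>2 * \<epsilon>\<close>, bounded by \<open>ret\<close>.
  Independence multiplies these factors.\<close>

lemma prob_visits_pair_le:
  assumes n: "n > 0" and \<sigma>: "\<And>k. \<sigma> k < N" and \<sigma>': "\<And>k. \<sigma>' k < N" and z0: "z 0 = x"
    and \<epsilon>: "0 < \<epsilon>" and N: "real N * \<epsilon>\<^sup>2 \<le> 2" and d: "DIM('a) \<ge> 3"
  defines "K \<equiv> unit_ball_vol DIM('a) / sqrt (1 / (2 * real n)) ^ DIM('a) * 2 ^ DIM('a)"
    and "c \<equiv> (unit_ball_vol DIM('a) + 1) * (4 * sqrt (real n)) ^ 3"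
  shows "prob (visits n N \<epsilon> z \<sigma> n \<inter> visits n N \<epsilon> z \<sigma>' n)
    \<le> (\<Prod>k\<in>{1..n}. K * \<epsilon> ^ DIM('a) * ret c ((\<sigma>' k - \<sigma> k) + (\<sigma> k - \<sigma>' k)))"
proof -
  let ?f = "\<lambda>k. wtime n N k (min (\<sigma> k) (\<sigma>' k))"
  let ?l = "\<lambda>k. wtime n N k (max (\<sigma> k) (\<sigma>' k))"
  let ?g = "\<lambda>k. ret c ((\<sigma>' k - \<sigma> k) + (\<sigma> k - \<sigma>' k))"
  have c: "c \<ge> 0" unfolding c_def by simp
  have K: "K \<ge> 0" unfolding K_def by simp
  have N0: "N > 0" using \<sigma>[of 0] by simp
  \<comment> \<open>Fixing the start makes index 0 behave like a visit to \<open>z 0 = x\<close>, so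
    the first step of the induction is like the others.\<close>
  define V where "V m = {\<omega> \<in> visits n N \<epsilon> z \<sigma> m \<inter> visits n N \<epsilon> z \<sigma>' m. W 0 \<omega> = x}" for m
  have near: "norm (W (?f k) \<omega> - z k) \<le> \<epsilon>" "norm (W (?l k) \<omega> - z k) \<le> \<epsilon>"
    if "\<omega> \<in> V m" "k \<le> m" for \<omega> k m
  proof -
    have "norm (W (wtime n N k i) \<omega> - z k) \<le> \<epsilon>" if i: "i = \<sigma> k \<or> i = \<sigma>' k" for i
    proof (cases "k = 0")
      case True
      then show ?thesis using \<open>\<omega> \<in> V m\<close> z0 \<epsilon> by (auto simp: V_def)
    next
      case False
      then have "k \<in> {1..m}" using \<open>k \<le> m\<close> by auto
      then show ?thesis using i \<open>\<omega> \<in> V m\<close> by (auto simp: V_def visits_def dist_norm norm_minus_commute)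
    qed
    then show "norm (W (?f k) \<omega> - z k) \<le> \<epsilon>" "norm (W (?l k) \<omega> - z k) \<le> \<epsilon>"
      by (auto simp: min_def max_def)
  qed
  have "\<exists>C. cyl (?l m) C \<and> prob C \<le> (\<Prod>k\<in>{1..m}. K * \<epsilon> ^ DIM('a) * ?g k) \<and> V m \<subseteq> C"
    if "m \<le> n" for m
    using that
  proof (induction m)
    case 0
    show ?case
      by (intro exI[of _ "space M"]) (use cyl.whole in \<open>auto simp: prob_space V_def visits_def\<close>)
  next
    case (Suc m)
    then obtain C where C: "cyl (?l m) C" "prob C \<le> (\<Prod>k\<in>{1..m}. K * \<epsilon> ^ DIM('a) * ?g k)" "V m \<subseteq> C"
      by auto
    let ?k = "Suc m"
    have gap: "1 / (2 * real n) \<le> ?f ?k - ?l m" by (rule wtime_gap[OF n]) (use \<sigma> \<sigma>' in auto)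
    moreover have n0: "0 < 1 / (2 * real n)" using n by simp
    ultimately have le: "?l m \<le> ?f ?k" by linarith
    have le': "?f ?k \<le> ?l ?k" by (auto simp: wtime_def intro!: divide_right_mono)
    have le1: "?l ?k \<le> 1" by (rule wtime_le_1[OF n]) (use \<sigma> \<sigma>' Suc.prems in auto)
    have le2: "?f ?k \<le> 1" using le' le1 by linarith
    let ?I = "{\<omega>\<in>space M. W (?f ?k) \<omega> - W (?l m) \<omega> \<in> cball (z ?k - z m) (2 * \<epsilon>)}"
    let ?J = "{\<omega>\<in>space M. W (?l ?k) \<omega> - W (?f ?k) \<omega> \<in> cball 0 (2 * \<epsilon>)}"
    have cyl1: "cyl (?f ?k) (C \<inter> ?I)" by (rule cyl.step[OF C(1) le le2]) auto
    have cyl2: "cyl (?l ?k) (C \<inter> ?I \<inter> ?J)" by (rule cyl.step[OF cyl1 le' le1]) auto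
    have I: "prob ?I \<le> K * \<epsilon> ^ DIM('a)"
    proof -
      have "prob ?I \<le> unit_ball_vol DIM('a) / sqrt (1 / (2 * real n)) ^ DIM('a) * (2 * \<epsilon>) ^ DIM('a)"
        using wtime_nonneg n0 \<epsilon> by (intro prob_increment_gap_le[OF _ gap le2]) auto
      then show ?thesis unfolding K_def by (simp add: power_mult_distrib)
    qed
    have J: "prob ?J \<le> ?g ?k"
    proof (cases "\<sigma> ?k = \<sigma>' ?k")
      case True
      then show ?thesis by (simp add: ret_def)
    next
      case False
      let ?j = "(\<sigma>' ?k - \<sigma> ?k) + (\<sigma> ?k - \<sigma>' ?k)"
      have j: "?j > 0" using False by arith
      have dt: "?l ?k - ?f ?k = real ?j / (2 * real n * real N)"
      proof -
        have "max (\<sigma> ?k) (\<sigma>' ?k) = min (\<sigma> ?k) (\<sigma>' ?k) + ?j" by arith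
        then have "real (max (\<sigma> ?k) (\<sigma>' ?k)) = real (min (\<sigma> ?k) (\<sigma>' ?k)) + real ?j"
          by (simp only: of_nat_add)
        then show ?thesis unfolding wtime_def by (simp only: add_divide_distrib) simp
      qed
      have "0 < real ?j" using j by (simp only: of_nat_0_less_iff)
      moreover have "0 < 2 * real n * real N" using n N0 by simp
      ultimately have pos: "0 < ?l ?k - ?f ?k" unfolding dt by (rule divide_pos_pos)
      \<comment> \<open>By \<open>dt\<close> the square of the left side is
        \<open>8 * n * (N * \<epsilon>\<^sup>2) / j\<close>, and
        \<open>N * \<epsilon>\<^sup>2 \<le> 2\<close> removes the dependence on
        \<open>\<epsilon>\<close>. This is the origin of \<open>4 * sqrt n\<close> in
        \<open>c\<close>.\<close>
      have "2 * \<epsilon> / sqrt (?l ?k - ?f ?k) \<le> 4 * sqrt (real n) / sqrt (real ?j)"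
      proof -
        have "(2 * \<epsilon> / sqrt (?l ?k - ?f ?k))\<^sup>2 = 8 * real n * (real N * \<epsilon>\<^sup>2) / real ?j"
          using pos n N0 by (simp add: power_divide power_mult_distrib) (simp add: dt field_simps)
        also have "\<dots> \<le> 8 * real n * 2 / real ?j"
          using N by (intro divide_right_mono mult_left_mono) auto
        also have "\<dots> = (4 * sqrt (real n) / sqrt (real ?j))\<^sup>2"
          by (simp add: power_divide power_mult_distrib)
        finally show ?thesis by (rule power2_le_imp_le) simp
      qed
      then have "(2 * \<epsilon> / sqrt (?l ?k - ?f ?k)) ^ 3 \<le> (4 * sqrt (real n) / sqrt (real ?j)) ^ 3"
        using \<epsilon> pos by (intro power_mono) auto
      moreover have "prob ?J \<le> (unit_ball_vol DIM('a) + 1) * (2 * \<epsilon> / sqrt (?l ?k - ?f ?k)) ^ 3"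
        using wtime_nonneg pos le1 \<epsilon> d by (intro prob_return_le) auto
      ultimately have "prob ?J \<le> (unit_ball_vol DIM('a) + 1) * (4 * sqrt (real n) / sqrt (real ?j)) ^ 3"
        by (meson order_trans mult_left_mono add_nonneg_nonneg unit_ball_vol_nonneg zero_le_one of_nat_0_le_iff)
      also have "\<dots> = ?g ?k" unfolding ret_pos[OF j] c_def power_divide by simp
      finally show ?thesis .
    qed
    have "prob (C \<inter> ?I \<inter> ?J) = prob C * prob ?I * prob ?J"
      by (subst prob_cyl_step[OF cyl1 le' le1], simp, subst prob_cyl_step[OF C(1) le le2]) auto
    also have "\<dots> \<le> (\<Prod>k\<in>{1..m}. K * \<epsilon> ^ DIM('a) * ?g k) * (K * \<epsilon> ^ DIM('a)) * ?g ?k"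
      using C(2) I J K \<epsilon> c by (intro mult_mono mult_nonneg_nonneg prod_nonneg ret_nonneg) auto
    also have "\<dots> = (\<Prod>k\<in>{1..?k}. K * \<epsilon> ^ DIM('a) * ?g k)" by simp
    finally have P: "prob (C \<inter> ?I \<inter> ?J) \<le> (\<Prod>k\<in>{1..?k}. K * \<epsilon> ^ DIM('a) * ?g k)" .
    have "V ?k \<subseteq> C \<inter> ?I \<inter> ?J"
    proof
      fix \<omega> assume \<omega>: "\<omega> \<in> V ?k"
      have sp: "\<omega> \<in> space M" using \<omega> by (auto simp: V_def visits_def)
      have "\<omega> \<in> V m" using \<omega> by (auto simp: V_def visits_def)
      then have 1: "\<omega> \<in> C" using C(3) by blast
      have a: "norm (W (?l m) \<omega> - z m) \<le> \<epsilon>" using near(2)[OF \<omega>, of m] by simp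
      have b: "norm (W (?f ?k) \<omega> - z ?k) \<le> \<epsilon>" "norm (W (?l ?k) \<omega> - z ?k) \<le> \<epsilon>"
        using near[OF \<omega>, of ?k] by simp_all
      have "norm ((z ?k - z m) - (W (?f ?k) \<omega> - W (?l m) \<omega>)) \<le> 2 * \<epsilon>"
        using norm_triangle_ineq4[of "W (?l m) \<omega> - z m" "W (?f ?k) \<omega> - z ?k"] a b(1)
        by (simp add: algebra_simps)
      then have 2: "\<omega> \<in> ?I" using sp by (simp add: dist_norm)
      have "norm (W (?l ?k) \<omega> - W (?f ?k) \<omega>) \<le> 2 * \<epsilon>"
        using norm_triangle_ineq4[of "W (?l ?k) \<omega> - z ?k" "W (?f ?k) \<omega> - z ?k"] b by simp
      then have 3: "\<omega> \<in> ?J" using sp by simp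
      from 1 2 3 show "\<omega> \<in> C \<inter> ?I \<inter> ?J" by blast
    qed
    with cyl2 P show ?case by blast
  qed
  from this[of n] obtain C where C: "cyl (?l n) C" "prob C \<le> (\<Prod>k\<in>{1..n}. K * \<epsilon> ^ DIM('a) * ?g k)" "V n \<subseteq> C"
    by auto
  have "prob (visits n N \<epsilon> z \<sigma> n \<inter> visits n N \<epsilon> z \<sigma>' n) \<le> prob C"
  proof (rule finite_measure_mono_AE[OF _ cyl_sets[OF C(1)]])
    show "AE \<omega> in M. \<omega> \<in> visits n N \<epsilon> z \<sigma> n \<inter> visits n N \<epsilon> z \<sigma>' n \<longrightarrow> \<omega> \<in> C"
      using start by (rule AE_mp, intro AE_I2 impI) (use C(3) in \<open>auto simp: V_def\<close>)
  qed
  then show ?thesis using C by linarith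
qed

text \<open>The first moment is at least \<open>N ^ n * (L * \<epsilon> ^ d) ^ n\<close>, the second
  at most \<open>N ^ n * (K * \<epsilon> ^ d * B) ^ n\<close>: for a fixed tuple, the sum over the
  other one factorises over the windows and each factor is a return series. The quotient is of order
  \<open>(N * \<epsilon> ^ d) ^ n\<close>.\<close>

lemma prob_visits_UN_ge:
  assumes n: "n > 0" and z0: "z 0 = x"
    and R: "\<And>k. k < n \<Longrightarrow> norm (z (Suc k) - z k) + 1 \<le> R" and \<epsilon>: "0 < \<epsilon>" "\<epsilon> \<le> 1"
    and N: "1 \<le> real N * \<epsilon>\<^sup>2" "real N * \<epsilon>\<^sup>2 \<le> 2" and d: "DIM('a) \<ge> 3"
  defines "K \<equiv> unit_ball_vol DIM('a) / sqrt (1 / (2 * real n)) ^ DIM('a) * 2 ^ DIM('a)"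
    and "c \<equiv> (unit_ball_vol DIM('a) + 1) * (4 * sqrt (real n)) ^ 3"
    and "L \<equiv> exp (- R\<^sup>2 * real n) / sqrt (2 * pi) ^ DIM('a) * unit_ball_vol DIM('a) / real n ^ DIM('a)"
  shows "(L\<^sup>2 / (2 * K * suminf (ret c))) ^ n * (\<epsilon> ^ (DIM('a) - 2)) ^ n
    \<le> prob (\<Union>\<sigma>\<in>{\<sigma>. \<forall>k. \<sigma> k < N}. visits n N \<epsilon> z \<sigma> n)"
proof -
  let ?d = "DIM('a)"
  define B where "B = 2 * suminf (ret c)"
  \<comment> \<open>The default value 0 outside \<open>{1..n}\<close> makes the index set finite and
    keeps \<open>\<sigma> k < N\<close> valid for every \<open>k\<close>, as the estimates for
    \<open>visits\<close> require.\<close>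
  define I where "I = PiE_dflt {1..n} 0 (\<lambda>_. {..<N})"
  have N0: "N > 0" using N by (cases N) auto
  have c: "c \<ge> 0" unfolding c_def by simp
  have ubv: "unit_ball_vol (real ?d) > 0" by simp
  have K: "K > 0" unfolding K_def using n ubv by simp
  have L: "L > 0" unfolding L_def using n ubv by simp
  have B: "B > 0" using suminf_ret_ge_1[OF c] by (simp add: B_def)
  have I: "\<sigma> k < N" if "\<sigma> \<in> I" for \<sigma> k
    using that N0 unfolding I_def PiE_dflt_def by (cases "k \<in> {1..n}") auto
  have finI: "finite I" unfolding I_def by (intro finite_PiE_dflt) auto
  have cardI: "card I = N ^ n" unfolding I_def by (subst card_PiE_dflt) auto
  have sumprod: "(\<Sum>\<sigma>\<in>I. \<Prod>k\<in>{1..n}. f k (\<sigma> k)) = (\<Prod>k\<in>{1..n}. \<Sum>i<N. f k i)" for f :: "nat \<Rightarrow> nat \<Rightarrow> real"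
  proof -
    have "(\<Sum>\<sigma>\<in>I. \<Prod>k\<in>{1..n}. f k (\<sigma> k)) = (\<Sum>\<sigma>\<in>PiE {1..n} (\<lambda>_. {..<N}). \<Prod>k\<in>{1..n}. f k (\<sigma> k))"
      by (rule sum.reindex_bij_witness[of _ "\<lambda>\<sigma> k. if k \<in> {1..n} then \<sigma> k else 0" "\<lambda>\<sigma>. restrict \<sigma> {1..n}"])
        (auto simp: I_def PiE_dflt_def fun_eq_iff PiE_def extensional_def intro!: prod.cong)
    also have "\<dots> = (\<Prod>k\<in>{1..n}. \<Sum>i<N. f k i)" by (rule prod_sum_PiE[symmetric]) auto
    finally show ?thesis .
  qed
  define S where "S = real N ^ n * (L * \<epsilon> ^ ?d) ^ n"
  define Q where "Q = real N ^ n * (K * \<epsilon> ^ ?d * B) ^ n"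
  have S: "S \<le> (\<Sum>\<sigma>\<in>I. prob (visits n N \<epsilon> z \<sigma> n))"
  proof -
    have "S = (\<Sum>\<sigma>\<in>I. (L * \<epsilon> ^ ?d) ^ n)" by (simp add: S_def cardI)
    also have "\<dots> \<le> (\<Sum>\<sigma>\<in>I. prob (visits n N \<epsilon> z \<sigma> n))"
    proof (rule sum_mono)
      fix \<sigma> assume \<sigma>: "\<sigma> \<in> I"
      have "L * \<epsilon> ^ ?d = exp (- R\<^sup>2 * real n) / sqrt (2 * pi) ^ ?d * unit_ball_vol ?d * (\<epsilon> / real n) ^ ?d"
        by (simp add: L_def power_divide)
      then show "(L * \<epsilon> ^ ?d) ^ n \<le> prob (visits n N \<epsilon> z \<sigma> n)"
        using prob_visits_ge[of n \<sigma> N z R \<epsilon>, OF n I[OF \<sigma>] z0 R \<epsilon>] by (simp only:)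
    qed
    finally show ?thesis .
  qed
  have Q: "(\<Sum>\<sigma>\<in>I. \<Sum>\<sigma>'\<in>I. prob (visits n N \<epsilon> z \<sigma> n \<inter> visits n N \<epsilon> z \<sigma>' n)) \<le> Q"
  proof -
    have "(\<Sum>\<sigma>'\<in>I. prob (visits n N \<epsilon> z \<sigma> n \<inter> visits n N \<epsilon> z \<sigma>' n)) \<le> (K * \<epsilon> ^ ?d * B) ^ n"
      if \<sigma>: "\<sigma> \<in> I" for \<sigma>
    proof -
      have "(\<Sum>\<sigma>'\<in>I. prob (visits n N \<epsilon> z \<sigma> n \<inter> visits n N \<epsilon> z \<sigma>' n))
        \<le> (\<Sum>\<sigma>'\<in>I. \<Prod>k\<in>{1..n}. K * \<epsilon> ^ ?d * ret c ((\<sigma>' k - \<sigma> k) + (\<sigma> k - \<sigma>' k)))"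
        unfolding K_def c_def
        by (intro sum_mono prob_visits_pair_le n z0 \<epsilon> N d I[OF \<sigma>] I)
      also have "\<dots> = (\<Prod>k\<in>{1..n}. \<Sum>i<N. K * \<epsilon> ^ ?d * ret c ((i - \<sigma> k) + (\<sigma> k - i)))"
        by (rule sumprod)
      also have "\<dots> \<le> (\<Prod>k\<in>{1..n}. K * \<epsilon> ^ ?d * B)"
      proof (rule prod_mono, intro conjI)
        fix k
        show "0 \<le> (\<Sum>i<N. K * \<epsilon> ^ ?d * ret c ((i - \<sigma> k) + (\<sigma> k - i)))"
          using K \<epsilon> ret_nonneg[OF c] by (intro sum_nonneg mult_nonneg_nonneg) auto
        show "(\<Sum>i<N. K * \<epsilon> ^ ?d * ret c ((i - \<sigma> k) + (\<sigma> k - i))) \<le> K * \<epsilon> ^ ?d * B"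
          unfolding sum_distrib_left[symmetric] B_def using K \<epsilon>
          by (intro mult_left_mono sum_ret_le c I[OF \<sigma>]) auto
      qed
      finally show ?thesis by simp
    qed
    then have "(\<Sum>\<sigma>\<in>I. \<Sum>\<sigma>'\<in>I. prob (visits n N \<epsilon> z \<sigma> n \<inter> visits n N \<epsilon> z \<sigma>' n))
      \<le> (\<Sum>\<sigma>\<in>I. (K * \<epsilon> ^ ?d * B) ^ n)" by (rule sum_mono)
    then show ?thesis by (simp add: Q_def cardI)
  qed
  have "S\<^sup>2 / Q \<le> prob (\<Union>\<sigma>\<in>I. visits n N \<epsilon> z \<sigma> n)"
  proof (rule second_moment_bound[OF finI _ S _ Q])
    show "0 < S" "0 < Q" using N0 L K B \<epsilon> by (auto simp: S_def Q_def)
  qed (use sets_visits[OF n] I in auto)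
  also have "\<dots> \<le> prob (\<Union>\<sigma>\<in>{\<sigma>. \<forall>k. \<sigma> k < N}. visits n N \<epsilon> z \<sigma> n)"
  proof (rule finite_measure_mono)
    have "(\<Union>\<sigma>\<in>{\<sigma>. \<forall>k. \<sigma> k < N}. visits n N \<epsilon> z \<sigma> n) = (\<Union>\<sigma>\<in>I. visits n N \<epsilon> z \<sigma> n)"
    proof (intro subset_antisym subsetI)
      fix \<omega> assume "\<omega> \<in> (\<Union>\<sigma>\<in>{\<sigma>. \<forall>k. \<sigma> k < N}. visits n N \<epsilon> z \<sigma> n)"
      then obtain \<sigma> where \<sigma>: "\<And>k. \<sigma> k < N" "\<omega> \<in> visits n N \<epsilon> z \<sigma> n" by blast
      have "(\<lambda>k. if k \<in> {1..n} then \<sigma> k else 0) \<in> I" using \<sigma> by (auto simp: I_def PiE_dflt_def)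
      moreover have "\<omega> \<in> visits n N \<epsilon> z (\<lambda>k. if k \<in> {1..n} then \<sigma> k else 0) n"
        using \<sigma>(2) by (auto simp: visits_def)
      ultimately show "\<omega> \<in> (\<Union>\<sigma>\<in>I. visits n N \<epsilon> z \<sigma> n)" by blast
    qed (use I in blast)
    then show "(\<Union>\<sigma>\<in>{\<sigma>. \<forall>k. \<sigma> k < N}. visits n N \<epsilon> z \<sigma> n) \<in> sets M"
      using finI sets_visits[OF n] I by auto
  qed (use I in blast)
  finally have main: "S\<^sup>2 / Q \<le> prob (\<Union>\<sigma>\<in>{\<sigma>. \<forall>k. \<sigma> k < N}. visits n N \<epsilon> z \<sigma> n)" .
  have "S\<^sup>2 / Q = (real N * L\<^sup>2 * \<epsilon> ^ ?d / (K * B)) ^ n"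
  proof -
    have "S\<^sup>2 / Q = ((real N * (L * \<epsilon> ^ ?d))\<^sup>2 / (real N * (K * \<epsilon> ^ ?d * B))) ^ n"
      unfolding S_def Q_def power_mult_distrib[symmetric]
      by (simp only: power_divide power_mult[symmetric] mult.commute)
    also have "(real N * (L * \<epsilon> ^ ?d))\<^sup>2 / (real N * (K * \<epsilon> ^ ?d * B)) = real N * L\<^sup>2 * \<epsilon> ^ ?d / (K * B)"
      using N0 \<epsilon> K B by (simp add: power2_eq_square field_simps)
    finally show ?thesis .
  qed
  moreover have "(L\<^sup>2 / (K * B) * \<epsilon> ^ (?d - 2)) ^ n \<le> (real N * L\<^sup>2 * \<epsilon> ^ ?d / (K * B)) ^ n"
  proof (rule power_mono)
    have "2 + (?d - 2) = ?d" using d by simp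
    then have e: "\<epsilon> ^ ?d = \<epsilon>\<^sup>2 * \<epsilon> ^ (?d - 2)"
      using power_add[of \<epsilon> 2 "?d - 2"] by (simp only:)
    \<comment> \<open>Here \<open>1 \<le> N * \<epsilon>\<^sup>2\<close> trades the number of time
      steps for \<open>1 / \<epsilon>\<^sup>2\<close>, which lowers the power from \<open>d\<close>
      to \<open>d - 2\<close>.\<close>
    have "1 * (L\<^sup>2 / (K * B) * \<epsilon> ^ (?d - 2)) \<le> (real N * \<epsilon>\<^sup>2) * (L\<^sup>2 / (K * B) * \<epsilon> ^ (?d - 2))"
      using N K B \<epsilon> by (intro mult_right_mono) auto
    then show "L\<^sup>2 / (K * B) * \<epsilon> ^ (?d - 2) \<le> real N * L\<^sup>2 * \<epsilon> ^ ?d / (K * B)"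
      unfolding e by (simp add: mult_ac)
  qed (use K B \<epsilon> in auto)
  moreover have e: "2 * K * suminf (ret c) = K * B" by (simp add: B_def)
  ultimately show ?thesis
    using main unfolding e power_mult_distrib[symmetric] by linarith
qed

end

section \<open>The two-sided estimate\<close>

lemma successively_map_upt:
  assumes "\<And>k. k < n \<Longrightarrow> P (f k) (f (Suc k))"
  shows "successively P (map f [0..<Suc n])"
  using assms by (auto simp: successively_conv_nth nth_append simp del: upt_Suc)

context brownian_motion
begin

lemma reach_iff_ordered_visits:
  assumes "2 * \<epsilon> < \<rho>" "successively (\<lambda>a b. dist a b \<ge> \<rho>) (map z [1..<Suc n])"
  shows "reach \<epsilon> (map z [1..<Suc n]) 0 \<omega> \<longleftrightarrow> (\<exists>t. strict_mono_on {1..n} t \<and>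
    (\<forall>k\<in>{1..n}. t k \<in> {0..1} \<and> W (t k) \<omega> \<in> cball (z k) \<epsilon>))"
proof -
  have "reach \<epsilon> (map z [1..<Suc n]) 0 \<omega> \<longleftrightarrow> (\<exists>t. strict_mono_on {..<n} t \<and>
    (\<forall>k<n. t k \<in> {0..1} \<and> W (t k) \<omega> \<in> cball (z (Suc k)) \<epsilon>))"
    unfolding reach_iff[OF assms] by (simp del: upt_Suc)
  also have "\<dots> \<longleftrightarrow> (\<exists>t. strict_mono_on {1..n} t \<and>
    (\<forall>k\<in>{1..n}. t k \<in> {0..1} \<and> W (t k) \<omega> \<in> cball (z k) \<epsilon>))"
  proof (intro iffI; elim exE conjE)
    fix t assume t: "strict_mono_on {..<n} t"
      "\<forall>k<n. t k \<in> {0..1} \<and> W (t k) \<omega> \<in> cball (z (Suc k)) \<epsilon>"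
    show "\<exists>t. strict_mono_on {1..n} t \<and> (\<forall>k\<in>{1..n}. t k \<in> {0..1} \<and> W (t k) \<omega> \<in> cball (z k) \<epsilon>)"
    proof (intro exI[of _ "\<lambda>k. t (k - 1)"] conjI ballI)
      show "strict_mono_on {1..n} (\<lambda>k. t (k - 1))"
        by (intro strict_mono_onI strict_mono_onD[OF t(1)]) auto
    next
      fix k assume "k \<in> {1..n}"
      then have "k - 1 < n" "Suc (k - 1) = k" by auto
      then show "t (k - 1) \<in> {0..1}" "W (t (k - 1)) \<omega> \<in> cball (z k) \<epsilon>"
        using t(2) by metis+
    qed
  next
    fix t assume t: "strict_mono_on {1..n} t"
      "\<forall>k\<in>{1..n}. t k \<in> {0..1} \<and> W (t k) \<omega> \<in> cball (z k) \<epsilon>"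
    show "\<exists>t. strict_mono_on {..<n} t \<and> (\<forall>k<n. t k \<in> {0..1} \<and> W (t k) \<omega> \<in> cball (z (Suc k)) \<epsilon>)"
    proof (intro exI[of _ "t \<circ> Suc"] conjI allI impI)
      show "strict_mono_on {..<n} (t \<circ> Suc)"
        unfolding o_def by (intro strict_mono_onI strict_mono_onD[OF t(1)]) auto
    qed (use t(2) in auto)
  qed
  finally show ?thesis .
qed

end

theorem theorem2p2:
  fixes x :: "'a::euclidean_space" and z :: "nat \<Rightarrow> 'a" and n :: nat
  assumes "DIM('a) \<ge> 3" and "n \<ge> 1"
    and "\<And>k. k \<in> {1..n} \<Longrightarrow> z k \<noteq> x"
    and "\<And>k j. k \<in> {1..n} \<Longrightarrow> j \<in> {1..n} \<Longrightarrow> k \<noteq> j \<Longrightarrow> z k \<noteq> z j"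
  shows "\<exists>\<epsilon>\<^sub>0>0. \<exists>c>0. \<exists>C\<ge>c. \<forall>(M :: 'w measure) W. brownian_motion M x W \<longrightarrow>
    (\<forall>\<epsilon>. 0 < \<epsilon> \<and> \<epsilon> < \<epsilon>\<^sub>0 \<longrightarrow>
      (let F = measure M {\<omega> \<in> space M. \<exists>t :: nat \<Rightarrow> real.
                 strict_mono_on {1..n} t \<and>
                 (\<forall>k\<in>{1..n}. t k \<in> {0..1} \<and> W (t k) \<omega> \<in> cball (z k) \<epsilon>)};
           G = norm (x - z 1) powi (2 - int DIM('a))
               * (\<Prod>k\<in>{1..<n}. norm (z k - z (Suc k)) powi (2 - int DIM('a)))
               * (\<epsilon> ^ (DIM('a) - 2)) ^ n
       in c * G \<le> F \<and> F \<le> C * G))"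
proof -
  let ?d = "DIM('a)"
  define y where "y = z(0 := x)"
  have y_ne: "y k \<noteq> y (Suc k)" if "k < n" for k
    using assms(3)[of "Suc k"] assms(4)[of k "Suc k"] that by (cases k) (auto simp: y_def)
  \<comment> \<open>The shortest step of the chain from \<open>x\<close> through the points; it is
    positive because neighbours differ. In \<open>R\<close> the summand 1 leaves room for the radius
    of the target balls.\<close>
  define \<rho> where "\<rho> = Min ((\<lambda>k. dist (y k) (y (Suc k))) ` {..<n})"
  define R where "R = Max ((\<lambda>k. norm (y (Suc k) - y k) + 1) ` {..<n})"
  have "\<rho> \<in> (\<lambda>k. dist (y k) (y (Suc k))) ` {..<n}"
    unfolding \<rho>_def using assms(2) by (intro Min_in) (auto simp: lessThan_empty_iff)
  then have \<rho>0: "\<rho> > 0" using y_ne by auto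
  have \<rho>: "\<rho> \<le> dist (y k) (y (Suc k))" if "k < n" for k
    unfolding \<rho>_def using that by (intro Min_le) auto
  have R: "norm (y (Suc k) - y k) + 1 \<le> R" if "k < n" for k
    unfolding R_def using that by (intro Max_ge) auto
  have n0: "n > 0" using assms(2) by simp
  have list: "x # map z [1..<Suc n] = map y [0..<Suc n]"
  proof -
    have "[0..<Suc n] = 0 # [1..<Suc n]" by (subst upt_conv_Cons) auto
    then show ?thesis by (simp add: y_def del: upt_Suc)
  qed
  have sep: "successively (\<lambda>a b. dist a b \<ge> \<rho>) (x # map z [1..<Suc n])"
    unfolding list by (rule successively_map_upt) (rule \<rho>)
  then have sep': "successively (\<lambda>a b. dist a b \<ge> \<rho>) (map z [1..<Suc n])"
    by (cases "map z [1..<Suc n]") (auto simp del: upt_Suc)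

  \<comment> \<open>Large enough for both conditions of \<open>prob_reach_le\<close>:
    \<open>q \<ge> 3\<close> and \<open>(?d - 2) * n + 2 \<le> 2 * q\<close>.\<close>
  define q where "q = (?d - 2) * n + 3"
  define K1 where "K1 = fact ?d * (8 / \<rho>\<^sup>2) ^ ?d * unit_ball_vol ?d + (2 / \<rho>) ^ ?d"
  define T :: "nat \<Rightarrow> real" where "T q = sqrt 2 ^ ?d * fact q * 4 ^ q" for q
  have K1: "K1 \<ge> 0" and T: "T q \<ge> 0" for q
    using \<rho>0 by (auto simp: K1_def T_def)
  define K0 where "K0 = 3 * 20 ^ ?d * K1 + 256 * 36 ^ ?d * K1 * T (?d + 3)"
  define upper where "upper = 128 * T q * (256 / \<rho>\<^sup>2) ^ q + K0 ^ n"
  define K where "K = unit_ball_vol ?d / sqrt (1 / (2 * real n)) ^ ?d * 2 ^ ?d"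
  define h where "h = (unit_ball_vol ?d + 1) * (4 * sqrt (real n)) ^ 3"
  define L where "L = exp (- R\<^sup>2 * real n) / sqrt (2 * pi) ^ ?d * unit_ball_vol ?d / real n ^ ?d"
  define lower where "lower = (L\<^sup>2 / (2 * K * suminf (ret h))) ^ n"
  have "unit_ball_vol (real ?d) > 0" by simp
  then have "K > 0" "L > 0" using n0 by (auto simp: K_def L_def)
  moreover have "suminf (ret h) > 0"
    by (rule less_le_trans[OF zero_less_one suminf_ret_ge_1]) (simp add: h_def)
  ultimately have lower: "lower > 0" by (auto simp: lower_def)

  \<comment> \<open>The constants above are fixed before the process, so they are uniform in
    \<open>M\<close> and \<open>W\<close>.\<close>
  have main: "lower * (\<epsilon> ^ (?d - 2)) ^ n \<le> F \<and> F \<le> upper * (\<epsilon> ^ (?d - 2)) ^ n"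
    if BM: "brownian_motion M x W" and \<epsilon>: "0 < \<epsilon>" "\<epsilon> < min 1 (\<rho> / 4)"
      and F: "F = measure M {\<omega> \<in> space M. \<exists>t :: nat \<Rightarrow> real. strict_mono_on {1..n} t \<and>
        (\<forall>k\<in>{1..n}. t k \<in> {0..1} \<and> W (t k) \<omega> \<in> cball (z k) \<epsilon>)}"
    for M :: "'w measure" and W \<epsilon> F
  proof -
    interpret brownian_motion M x W by (rule BM)
    define N where "N = nat \<lceil>1 / \<epsilon>\<^sup>2\<rceil>"
    have "1 \<le> 1 / \<epsilon>\<^sup>2" using \<epsilon> by (simp add: power_le_one)
    then have "1 / \<epsilon>\<^sup>2 \<le> real N" "real N \<le> 2 / \<epsilon>\<^sup>2"
      unfolding N_def by linarith+
    then have N: "1 \<le> real N * \<epsilon>\<^sup>2" "real N * \<epsilon>\<^sup>2 \<le> 2"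
      using \<epsilon> by (auto simp: field_simps)
    have \<epsilon>': "\<epsilon> \<le> 1" "4 * \<epsilon> \<le> \<rho>" "2 * \<epsilon> < \<rho>" using \<epsilon> by auto
    note reach = reach_iff_ordered_visits[OF \<epsilon>'(3) sep']
    have F': "F = prob {\<omega>\<in>space M. reach \<epsilon> (map z [1..<Suc n]) 0 \<omega>}"
      unfolding F reach ..
    have "F \<le> upper * (\<epsilon> ^ (?d - 2)) ^ length (map z [1..<Suc n])"
    proof -
      have "length (map z [1..<Suc n]) = n" by simp
      then have u: "upper = 128 * T q * (256 / \<rho>\<^sup>2) ^ q
          + (3 * 20 ^ ?d * K1 + 256 * 36 ^ ?d * K1 * T (?d + 3)) ^ length (map z [1..<Suc n])"
        unfolding upper_def K0_def by (simp only:)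
      have away: "prob {\<omega> \<in> space M. W t \<omega> - W s \<omega> \<in> cball w r} \<le> K1 * r ^ ?d"
        if "0 \<le> s" "s \<le> t" "t \<le> 1" "norm w \<ge> \<rho>" "r \<ge> 0" for s t w r
        unfolding K1_def using that \<rho>0 by (intro prob_increment_away_le) auto
      have tail: "prob {\<omega> \<in> space M. W t \<omega> - W s \<omega> \<in> {y. norm y \<ge> r}} \<le> T p * \<eta> ^ p"
        if "0 \<le> s" "s \<le> t" "t \<le> 1" "r > 0" "(t - s) / r\<^sup>2 \<le> \<eta>" for s t r \<eta> p
        unfolding T_def using that by (intro prob_increment_tail_le) auto
      show ?thesis
        unfolding F' u
        by (rule prob_reach_le[OF N \<epsilon>(1) \<epsilon>'(1) away K1 tail T tail T])
          (use sep \<epsilon>' assms(1) in \<open>auto simp: q_def simp del: upt_Suc\<close>)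
    qed
    moreover have "lower * (\<epsilon> ^ (?d - 2)) ^ n \<le> F"
    proof -
      have "lower * (\<epsilon> ^ (?d - 2)) ^ n \<le> prob (\<Union>\<sigma>\<in>{\<sigma>. \<forall>k. \<sigma> k < N}. visits n N \<epsilon> y \<sigma> n)"
        unfolding lower_def L_def K_def h_def
        by (rule prob_visits_UN_ge[where z = y and R = R, OF n0 _ R \<epsilon>(1) \<epsilon>'(1) N assms(1)]) (simp_all add: y_def)
      also have "\<dots> \<le> F"
        unfolding F'
      proof (rule finite_measure_mono)
        show "(\<Union>\<sigma>\<in>{\<sigma>. \<forall>k. \<sigma> k < N}. visits n N \<epsilon> y \<sigma> n) \<subseteq> {\<omega>\<in>space M. reach \<epsilon> (map z [1..<Suc n]) 0 \<omega>}"
        proof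
          fix \<omega> assume "\<omega> \<in> (\<Union>\<sigma>\<in>{\<sigma>. \<forall>k. \<sigma> k < N}. visits n N \<epsilon> y \<sigma> n)"
          then obtain \<sigma> where \<sigma>: "\<And>k. \<sigma> k < N" and \<omega>: "\<omega> \<in> visits n N \<epsilon> y \<sigma> n" by blast
          have "reach \<epsilon> (map z [1..<Suc n]) 0 \<omega>"
            unfolding reach
          proof (intro exI[of _ "\<lambda>k. wtime n N k (\<sigma> k)"] conjI ballI)
            show "strict_mono_on {1..n} (\<lambda>k. wtime n N k (\<sigma> k))"
              by (intro strict_mono_onI wtime_strict_mono[OF n0, of n]) (auto simp: \<sigma>)
          next
            fix k assume k: "k \<in> {1..n}"
            then show "wtime n N k (\<sigma> k) \<in> {0..1}"
              using wtime_nonneg wtime_le_1[OF n0 \<sigma>] by auto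
            show "W (wtime n N k (\<sigma> k)) \<omega> \<in> cball (z k) \<epsilon>"
              using k \<omega> by (auto simp: visits_def y_def)
          qed
          then show "\<omega> \<in> {\<omega>\<in>space M. reach \<epsilon> (map z [1..<Suc n]) 0 \<omega>}"
            using \<omega> by (auto simp: visits_def)
        qed
      qed (rule sets_reach, simp)
      finally show ?thesis .
    qed
    ultimately show ?thesis by (simp del: upt_Suc)
  qed

  \<comment> \<open>The part of \<open>G\<close> free of \<open>\<epsilon>\<close>. Being positive,
    it can be divided out of both constants; the maximum in the choice of the upper constant ensures
    that it is not below the lower one.\<close>
  define G0 where "G0 = norm (x - z 1) powi (2 - int ?d)
    * (\<Prod>k\<in>{1..<n}. norm (z k - z (Suc k)) powi (2 - int ?d))"
  have "norm (x - z 1) > 0" using assms(3)[of 1] assms(2) by auto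
  moreover have "norm (z k - z (Suc k)) > 0" if "k \<in> {1..<n}" for k
    using assms(4)[of k "Suc k"] that by auto
  ultimately have G0: "G0 > 0"
    unfolding G0_def by (intro mult_pos_pos prod_pos zero_less_power_int) auto
  show ?thesis
  proof (rule exI[of _ "min 1 (\<rho> / 4)"], rule conjI[rotated],
      rule exI[of _ "lower / G0"], rule conjI[rotated],
      rule exI[of _ "max (lower / G0) (upper / G0)"], rule conjI[rotated], intro allI impI)
    fix M :: "'w measure" and W \<epsilon>
    assume BM: "brownian_motion M x W" and \<epsilon>: "0 < \<epsilon> \<and> \<epsilon> < min 1 (\<rho> / 4)"
    define E where "E = (\<epsilon> ^ (?d - 2)) ^ n"
    have E: "E \<ge> 0" using \<epsilon> by (simp add: E_def)
    have "upper / G0 * (G0 * E) \<le> max (lower / G0) (upper / G0) * (G0 * E)"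
      using G0 E by (intro mult_right_mono) auto
    then have up: "upper * E \<le> max (lower / G0) (upper / G0) * (G0 * E)"
      and low: "lower / G0 * (G0 * E) = lower * E"
      using G0 by simp_all
    from \<epsilon> have "0 < \<epsilon>" "\<epsilon> < min 1 (\<rho> / 4)" by blast+
    note bounds = main[OF BM this refl, folded E_def]
    show "let F = measure M {\<omega> \<in> space M. \<exists>t :: nat \<Rightarrow> real.
                 strict_mono_on {1..n} t \<and>
                 (\<forall>k\<in>{1..n}. t k \<in> {0..1} \<and> W (t k) \<omega> \<in> cball (z k) \<epsilon>)};
           G = norm (x - z 1) powi (2 - int DIM('a))
               * (\<Prod>k\<in>{1..<n}. norm (z k - z (Suc k)) powi (2 - int DIM('a)))
               * (\<epsilon> ^ (DIM('a) - 2)) ^ n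
       in lower / G0 * G \<le> F \<and> F \<le> max (lower / G0) (upper / G0) * G"
      unfolding Let_def G0_def[symmetric] E_def[symmetric] low
      by (rule conjI[OF conjunct1[OF bounds] order_trans[OF conjunct2[OF bounds] up]])
  qed (use \<rho>0 lower G0 in auto)
qed

end
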